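(* For every nonnegative integer $n$, there exists an $\mathrm{RDSQS}(2^{2n+1}+2)$.
   Context: A Steiner quadruple system $\mathrm{SQS}(v)$ is a pair $(X,\mathcal{B})$ with $|X|=v$ and $\mathcal{B}$ a set of $4$-subsets of $X$ (blocks) such that every $3$-subset of $X$ lies in exactly one block. For $x\in X$, the derived design at $x$ is $(X\setminus\{x\},\{B\setminus\{x\}: x\in B\in\mathcal{B}\})$, which is a Steiner triple system $\mathrm{STS}(v-1)$ (every pair of points in exactly one $3$-subset block). A parallel class of a set $Y$ is a set of pairwise disjoint blocks whose union is $Y$; a design is resolvable if its block set can be partitioned into parallel classes of its point set (a resolvable $\mathrm{STS}$ is a Kirkman triple system). An $\mathrm{RDSQS}(v)$ is an $\mathrm{SQS}(v)$ whose derived design at every point is resolvable. *)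

theory Defs
  imports Main
begin

definition is_SQS :: "'a set \<Rightarrow> 'a set set \<Rightarrow> bool" where
  "is_SQS X B \<longleftrightarrow> finite X \<and> (\<forall>b\<in>B. b \<subseteq> X \<and> card b = 4) \<and>
     (\<forall>T. T \<subseteq> X \<and> card T = 3 \<longrightarrow> (\<exists>!b. b \<in> B \<and> T \<subseteq> b))"

definition derived_blocks :: "'a set set \<Rightarrow> 'a \<Rightarrow> 'a set set" where
  "derived_blocks B x = {b - {x} | b. b \<in> B \<and> x \<in> b}"

definition parallel_class :: "'a set \<Rightarrow> 'a set set \<Rightarrow> bool" where
  "parallel_class Y P \<longleftrightarrow> (\<forall>b\<in>P. \<forall>c\<in>P. b \<noteq> c \<longrightarrow> b \<inter> c = {}) \<and> \<Union>P = Y"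

definition resolvable :: "'a set \<Rightarrow> 'a set set \<Rightarrow> bool" where
  "resolvable Y B \<longleftrightarrow> (\<exists>R. (\<forall>P\<in>R. P \<noteq> {} \<and> parallel_class Y P) \<and>
      (\<forall>P\<in>R. \<forall>Q\<in>R. P \<noteq> Q \<longrightarrow> P \<inter> Q = {}) \<and> \<Union>R = B)"

definition is_RDSQS :: "'a set \<Rightarrow> 'a set set \<Rightarrow> bool" where
  "is_RDSQS X B \<longleftrightarrow> is_SQS X B \<and> (\<forall>x\<in>X. resolvable (X - {x}) (derived_blocks B x))"

end

theory Submission
  imports Defs "HOL-Library.FuncSet" "HOL-Library.Function_Algebras"
    "HOL-Library.Product_Plus" "HOL-Library.Z2"
begin

text \<open>
  The points are \<open>V \<times> \<int>\<^sub>2\<close> together with two stems, where \<open>V\<close> is the space of \<open>n\<close>-vectors over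
  the field with four elements. Blocks are of two kinds. For every affine line \<open>l\<close> of \<open>V\<close> there is a
  copy of SQS(10) on \<open>l \<times> \<int>\<^sub>2\<close> and the stems; any two copies share at most one block, consisting of
  the stems and the two points over a common point of the lines. A triple with three
  non-collinear \<open>V\<close>-coordinates \<open>x\<close>, \<open>y\<close>, \<open>z\<close> is completed by a point over \<open>x + y + z\<close>, whose
  \<open>\<int>\<^sub>2\<close>-coordinate is determined by a sign attached to the direction of the plane
  \<open>{x, y, z, x + y + z}\<close>.

  At every point the parallel classes are indexed by \<open>V\<close>. Each point of the SQS(10) on \<open>l\<close> has four
  parallel classes, which can be labelled by the points of \<open>l\<close> so that the block through the stems
  and the fibre of \<open>a\<close> always has label \<open>a\<close>. At a stem, class \<open>c\<close> is the union of the classes \<open>c\<close> on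
  all lines through \<open>c\<close>. At a point over \<open>x\<close>, class \<open>x\<close> is the union of the classes \<open>x\<close> on all
  lines through \<open>x\<close>, and class \<open>c \<noteq> x\<close> consists of class \<open>c\<close> on the line \<open>xc\<close> and a holey parallel
  class that covers the points off this line. The holey classes form a Kirkman frame on the nonzero
  vectors times \<open>\<int>\<^sub>2\<close> whose groups come from the one-dimensional subspaces. Its triples span
  two-dimensional subspaces, so it suffices to have such a frame in dimension two, where it is
  a finite table.
\<close>

section \<open>Steiner quadruple systems with coloured blocks\<close>

text \<open>\<open>K p c\<close> is the parallel class with label \<open>c\<close> of the derived design at \<open>p\<close>, with \<open>p\<close> added back to its
  blocks.\<close>

definition coloured_SQS ::
  "'a set \<Rightarrow> 'a set set \<Rightarrow> 'c set \<Rightarrow> ('a \<Rightarrow> 'c \<Rightarrow> 'a set set) \<Rightarrow> bool" where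
  "coloured_SQS X B C K \<longleftrightarrow>
     (\<forall>b\<in>B. b \<subseteq> X \<and> card b = 4) \<and>
     (\<forall>p\<in>X. \<forall>q\<in>X. \<forall>r\<in>X. distinct [p, q, r] \<longrightarrow> (\<exists>!b. b \<in> B \<and> p \<in> b \<and> q \<in> b \<and> r \<in> b)) \<and>
     (\<forall>p\<in>X. \<forall>c\<in>C. K p c \<subseteq> {b \<in> B. p \<in> b}) \<and>
     (\<forall>p\<in>X. \<forall>b\<in>B. p \<in> b \<longrightarrow> (\<exists>!c. c \<in> C \<and> b \<in> K p c)) \<and>
     (\<forall>p\<in>X. \<forall>q\<in>X. \<forall>c\<in>C. p \<noteq> q \<longrightarrow> (\<exists>!b. b \<in> K p c \<and> q \<in> b))"

lemma coloured_SQSD: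
  assumes "coloured_SQS X B C K"
  shows "b \<in> B \<Longrightarrow> b \<subseteq> X" "b \<in> B \<Longrightarrow> card b = 4"
    and "\<lbrakk>p \<in> X; q \<in> X; r \<in> X; distinct [p, q, r]\<rbrakk> \<Longrightarrow> \<exists>!b. b \<in> B \<and> p \<in> b \<and> q \<in> b \<and> r \<in> b"
    and "\<lbrakk>b \<in> K p c; p \<in> X; c \<in> C\<rbrakk> \<Longrightarrow> b \<in> B" "\<lbrakk>b \<in> K p c; p \<in> X; c \<in> C\<rbrakk> \<Longrightarrow> p \<in> b"
    and "\<lbrakk>p \<in> X; b \<in> B; p \<in> b\<rbrakk> \<Longrightarrow> \<exists>!c. c \<in> C \<and> b \<in> K p c"
    and "\<lbrakk>p \<in> X; q \<in> X; c \<in> C; p \<noteq> q\<rbrakk> \<Longrightarrow> \<exists>!b. b \<in> K p c \<and> q \<in> b"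
proof -
  note D = assms[unfolded coloured_SQS_def]
  note D1 = D[THEN conjunct1] and D2 = D[THEN conjunct2, THEN conjunct1]
    and D3 = D[THEN conjunct2, THEN conjunct2, THEN conjunct1]
    and D4 = D[THEN conjunct2, THEN conjunct2, THEN conjunct2, THEN conjunct1]
    and D5 = D[THEN conjunct2, THEN conjunct2, THEN conjunct2, THEN conjunct2]
  show "b \<in> B \<Longrightarrow> b \<subseteq> X" "b \<in> B \<Longrightarrow> card b = 4"
    using D1 by auto
  show "\<lbrakk>p \<in> X; q \<in> X; r \<in> X; distinct [p, q, r]\<rbrakk> \<Longrightarrow> \<exists>!b. b \<in> B \<and> p \<in> b \<and> q \<in> b \<and> r \<in> b"
    by (rule D2[rule_format])
  show "\<lbrakk>b \<in> K p c; p \<in> X; c \<in> C\<rbrakk> \<Longrightarrow> b \<in> B" "\<lbrakk>b \<in> K p c; p \<in> X; c \<in> C\<rbrakk> \<Longrightarrow> p \<in> b"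
    using D3 by blast+
  show "\<lbrakk>p \<in> X; b \<in> B; p \<in> b\<rbrakk> \<Longrightarrow> \<exists>!c. c \<in> C \<and> b \<in> K p c"
    by (rule D4[rule_format])
  show "\<lbrakk>p \<in> X; q \<in> X; c \<in> C; p \<noteq> q\<rbrakk> \<Longrightarrow> \<exists>!b. b \<in> K p c \<and> q \<in> b"
    by (rule D5[rule_format])
qed

text \<open>Removing \<open>p\<close> from the blocks of each \<open>K p c\<close> gives the
  resolution. A block has only one label at \<open>p\<close>, so different classes are disjoint;
  \<open>two\<close> makes every class nonempty.\<close>

lemma coloured_SQS_imp_RDSQS:
  assumes "coloured_SQS X B C K" and "finite X" and two: "\<And>p. p \<in> X \<Longrightarrow> \<exists>q\<in>X. q \<noteq> p"
  shows "is_RDSQS X B"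
proof -
  note B = coloured_SQSD(1,2)[OF assms(1)] and triple = coloured_SQSD(3)[OF assms(1)]
    and K = coloured_SQSD(4,5)[OF assms(1)] and colour = coloured_SQSD(6)[OF assms(1)]
    and pair = coloured_SQSD(7)[OF assms(1)]
  have "\<exists>!b. b \<in> B \<and> T \<subseteq> b" if T: "T \<subseteq> X \<and> card T = 3" for T
  proof -
    obtain p q r where "T = {p, q, r}" "distinct [p, q, r]"
      using T card_3_iff[of T] by auto
    then show ?thesis
      using triple[of p q r] T by simp
  qed
  then have "is_SQS X B"
    using B \<open>finite X\<close> by (simp add: is_SQS_def)
  moreover have "resolvable (X - {p}) (derived_blocks B p)" if p: "p \<in> X" for p
    unfolding resolvable_def
  proof (intro exI conjI ballI impI)
    let ?R = "(\<lambda>c. (\<lambda>b. b - {p}) ` K p c) ` C"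
    fix P assume "P \<in> ?R"
    then obtain c where c: "c \<in> C" and P: "P = (\<lambda>b. b - {p}) ` K p c" by auto
    obtain q where "q \<in> X" "q \<noteq> p" using two[OF p] by auto
    with pair[OF p _ c] show "P \<noteq> {}" unfolding P by blast
    show "parallel_class (X - {p}) P"
      unfolding parallel_class_def
    proof (intro conjI ballI impI)
      fix s t assume "s \<in> P" "t \<in> P" "s \<noteq> t"
      then obtain b d where bd: "b \<in> K p c" "d \<in> K p c" "s = b - {p}" "t = d - {p}" "b \<noteq> d"
        unfolding P by auto
      show "s \<inter> t = {}"
      proof (rule ccontr)
        assume "s \<inter> t \<noteq> {}"
        then obtain q where q: "q \<in> b" "q \<in> d" "q \<noteq> p" using bd by auto
        then have "q \<in> X" using bd(1) K(1)[OF _ p c] B by blast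
        with q pair[OF p _ c] bd show False by metis
      qed
    next
      have "q \<in> \<Union>P" if q: "q \<in> X" "q \<noteq> p" for q
      proof -
        obtain b where "b \<in> K p c" "q \<in> b" using pair[OF p q(1) c] q(2) by blast
        with q show ?thesis unfolding P by auto
      qed
      moreover have "\<Union>P \<subseteq> X - {p}"
        using K(1)[OF _ p c] B unfolding P by blast
      ultimately show "\<Union>P = X - {p}" by blast
    qed
    fix Q assume "Q \<in> ?R" "P \<noteq> Q"
    then obtain d where d: "d \<in> C" and Q: "Q = (\<lambda>b. b - {p}) ` K p d" by auto
    have "c \<noteq> d" using \<open>P \<noteq> Q\<close> P Q by auto
    show "P \<inter> Q = {}"
    proof (rule ccontr)
      assume "P \<inter> Q \<noteq> {}"
      then obtain s b b' where b: "b \<in> K p c" "b' \<in> K p d" "s = b - {p}" "s = b' - {p}"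
        unfolding P Q by auto
      moreover have "p \<in> b" "b \<in> B" "p \<in> b'"
        using K[OF b(1) p c] K(2)[OF b(2) p d] by simp_all
      ultimately have "b = b'" by blast
      with colour[OF p \<open>b \<in> B\<close> \<open>p \<in> b\<close>] b(1,2) \<open>c \<noteq> d\<close> c d show False by metis
    qed
  next
    show "\<Union> ((\<lambda>c. (\<lambda>b. b - {p}) ` K p c) ` C) = derived_blocks B p"
    proof (intro subset_antisym subsetI)
      fix s assume "s \<in> \<Union> ((\<lambda>c. (\<lambda>b. b - {p}) ` K p c) ` C)"
      then obtain c b where c: "c \<in> C" "b \<in> K p c" "s = b - {p}" by auto
      then show "s \<in> derived_blocks B p"
        using K[OF c(2) p c(1)] unfolding derived_blocks_def by blast
    next
      fix s assume "s \<in> derived_blocks B p"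
      then obtain b where b: "b \<in> B" "p \<in> b" "s = b - {p}" unfolding derived_blocks_def by blast
      obtain c where "c \<in> C" "b \<in> K p c" using colour[OF p b(1,2)] by blast
      with b(3) show "s \<in> \<Union> ((\<lambda>c. (\<lambda>b. b - {p}) ` K p c) ` C)" by blast
    qed
  qed
  ultimately show ?thesis by (simp add: is_RDSQS_def)
qed

text \<open>Points and labels are renamed separately: the SQS(10) moves onto a line together with
  its labels, the final system moves to natural numbers with its labels kept.\<close>

lemma coloured_SQS_image:
  assumes S: "coloured_SQS X B C K" and f: "inj_on f X" and g: "inj_on g C"
  shows "coloured_SQS (f ` X) ((`) f ` B) (g ` C)
           (\<lambda>p c. (`) f ` K (inv_into X f p) (inv_into C g c))"
proof -
  note sub = coloured_SQSD(1,2)[OF S] and K = coloured_SQSD(4,5)[OF S]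
  have mem: "f p \<in> f ` b \<longleftrightarrow> p \<in> b" if "p \<in> X" "b \<in> B" for p b
    using inj_on_image_mem_iff[OF f that(1) sub(1)[OF that(2)]] .
  have eq: "f ` b = f ` d \<longleftrightarrow> b = d" if "b \<in> B" "d \<in> B" for b d
    using inj_on_image_eq_iff[OF f] sub that by blast
  have memK: "f ` b \<in> (`) f ` K p c \<longleftrightarrow> b \<in> K p c" if "b \<in> B" "p \<in> X" "c \<in> C" for b p c
  proof
    assume "f ` b \<in> (`) f ` K p c"
    then obtain d where d: "d \<in> K p c" "f ` b = f ` d" by (auto simp only: image_iff)
    then have "b = d" using eq[OF that(1) K(1)[OF d(1) that(2,3)]] by simp
    with d show "b \<in> K p c" by simp
  qed (rule imageI)
  show ?thesis
    unfolding coloured_SQS_def ball_simps(9)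
  proof (intro conjI ballI impI)
    fix b assume "b \<in> B"
    then show "f ` b \<subseteq> f ` X" "card (f ` b) = 4"
      using sub[of b] card_image[OF inj_on_subset[OF f]] by auto
  next
    fix p q r assume pqr: "p \<in> X" "q \<in> X" "r \<in> X" "distinct [f p, f q, f r]"
    then have "\<exists>!b. b \<in> B \<and> p \<in> b \<and> q \<in> b \<and> r \<in> b"
      using coloured_SQSD(3)[OF S pqr(1-3)] by auto
    then obtain b where b: "b \<in> B" "p \<in> b" "q \<in> b" "r \<in> b"
      and u: "\<And>d. \<lbrakk>d \<in> B; p \<in> d; q \<in> d; r \<in> d\<rbrakk> \<Longrightarrow> d = b" by metis
    show "\<exists>!b. b \<in> (`) f ` B \<and> f p \<in> b \<and> f q \<in> b \<and> f r \<in> b"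
    proof (rule ex1I[of _ "f ` b"])
      show "f ` b \<in> (`) f ` B \<and> f p \<in> f ` b \<and> f q \<in> f ` b \<and> f r \<in> f ` b" using b by auto
      fix d assume d: "d \<in> (`) f ` B \<and> f p \<in> d \<and> f q \<in> d \<and> f r \<in> d"
      then obtain e where e: "e \<in> B" "d = f ` e" by blast
      then have "p \<in> e" "q \<in> e" "r \<in> e" using d mem pqr by simp_all
      then show "d = f ` b" using u e by simp
    qed
  next
    fix p c assume "p \<in> X" "c \<in> C"
    then show "(`) f ` K (inv_into X f (f p)) (inv_into C g (g c)) \<subseteq> {b \<in> (`) f ` B. f p \<in> b}"
      using K f g by auto
  next
    fix p b assume pb: "p \<in> X" "b \<in> B" "f p \<in> f ` b"
    then have "\<exists>!c. c \<in> C \<and> b \<in> K p c" 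
      using coloured_SQSD(6)[OF S] mem by blast
    then obtain c where c: "c \<in> C" "b \<in> K p c" and u: "\<And>d. \<lbrakk>d \<in> C; b \<in> K p d\<rbrakk> \<Longrightarrow> d = c" by metis
    show "\<exists>!c. c \<in> g ` C \<and> f ` b \<in> (`) f ` K (inv_into X f (f p)) (inv_into C g c)"
    proof (rule ex1I[of _ "g c"])
      show "g c \<in> g ` C \<and> f ` b \<in> (`) f ` K (inv_into X f (f p)) (inv_into C g (g c))"
        using c f g pb by auto
      fix d assume d: "d \<in> g ` C \<and> f ` b \<in> (`) f ` K (inv_into X f (f p)) (inv_into C g d)"
      then obtain e where e: "e \<in> C" "d = g e" by blast
      then have "f ` b \<in> (`) f ` K p e" using d f g pb(1) by simp
      then show "d = g c"
        using u[OF e(1)] memK[OF pb(2,1) e(1)] e(2) by simp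
    qed
  next
    fix p q c assume pq: "p \<in> X" "q \<in> X" "c \<in> C" "f p \<noteq> f q"
    then have "\<exists>!b. b \<in> K p c \<and> q \<in> b"
      using coloured_SQSD(7)[OF S] by blast
    then obtain b where b: "b \<in> K p c" "q \<in> b" and u: "\<And>d. \<lbrakk>d \<in> K p c; q \<in> d\<rbrakk> \<Longrightarrow> d = b" by metis
    have inv: "inv_into X f (f p) = p" "inv_into C g (g c) = c" using pq f g by auto
    show "\<exists>!b. b \<in> (`) f ` K (inv_into X f (f p)) (inv_into C g (g c)) \<and> f q \<in> b"
      unfolding inv
    proof (rule ex1I[of _ "f ` b"])
      show "f ` b \<in> (`) f ` K p c \<and> f q \<in> f ` b" using b by auto
      fix d assume d: "d \<in> (`) f ` K p c \<and> f q \<in> d"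
      then obtain e where e: "e \<in> K p c" "d = f ` e" by blast
      then have "q \<in> e" using d mem[OF pq(2) K(1)[OF e(1) pq(1,3)]] by simp
      then show "d = f ` b" using u e by simp
    qed
  qed
qed

section \<open>Gluing along a linear space\<close>

text \<open>The two stems are \<open>Inr 0\<close> and \<open>Inr 1\<close>.\<close>

type_synonym 'v stem_pt = "'v \<times> bit + bit"

definition stem_points :: "'v set \<Rightarrow> 'v stem_pt set" where
  "stem_points L = (L \<times> UNIV) <+> UNIV"

definition stem_quad :: "'v \<Rightarrow> 'v stem_pt set" where
  "stem_quad a = {Inl (a, 0), Inl (a, 1), Inr 0, Inr 1}"

text \<open>The label condition makes gluing possible: copies on two lines through \<open>a\<close>
  share \<open>stem_quad a\<close>, which must get the same label in both.\<close>

definition stemmed :: "'v set \<Rightarrow> 'v stem_pt set set \<Rightarrow> ('v stem_pt \<Rightarrow> 'v \<Rightarrow> 'v stem_pt set set) \<Rightarrow> bool" where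
  "stemmed L B K \<longleftrightarrow> coloured_SQS (stem_points L) B L K \<and>
     (\<forall>a\<in>L. stem_quad a \<in> B \<and> (\<forall>p\<in>stem_quad a. stem_quad a \<in> K p a))"

lemma Inl_mem_stem_points [simp]: "Inl p \<in> stem_points L \<longleftrightarrow> fst p \<in> L"
  by (cases p) (auto simp: stem_points_def)

lemma Inr_mem_stem_points [simp]: "Inr k \<in> stem_points L"
  by (auto simp: stem_points_def)

lemma Inl_mem_stem_quad [simp]: "Inl p \<in> stem_quad a \<longleftrightarrow> fst p = a"
  by (cases p; cases "snd p") (auto simp: stem_quad_def)

lemma Inr_mem_stem_quad [simp]: "Inr k \<in> stem_quad a"
  by (cases k) (auto simp: stem_quad_def)

lemma stemmed_image:
  assumes S: "stemmed L B K" and g: "inj_on g L"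
  shows "\<exists>B' K'. stemmed (g ` L) B' K'"
proof -
  let ?f = "map_sum (map_prod g id) id :: 'a stem_pt \<Rightarrow> 'b stem_pt"
  have f: "inj_on ?f (stem_points L)"
  proof (rule inj_onI)
    fix s t assume "s \<in> stem_points L" "t \<in> stem_points L" "?f s = ?f t"
    then show "s = t"
      by (cases s; cases t) (auto simp: stem_points_def dest: inj_onD[OF g])
  qed
  have im: "?f ` stem_points L = stem_points (g ` L)"
    by (force simp: stem_points_def image_iff)
  have sp: "?f ` stem_quad a = stem_quad (g a)" for a
    by (simp add: stem_quad_def)
  have "stem_quad a \<subseteq> stem_points L" if "a \<in> L" for a using that by (auto simp: stem_quad_def)
  then have inv: "inv_into (stem_points L) ?f (?f p) = p" if "p \<in> stem_quad a" "a \<in> L" for p a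
    using f that by (meson inv_into_f_f subsetD)
  let ?K = "\<lambda>p c. (`) ?f ` K (inv_into (stem_points L) ?f p) (inv_into L g c)"
  have "coloured_SQS (stem_points (g ` L)) ((`) ?f ` B) (g ` L) ?K"
    using coloured_SQS_image[OF _ f g] S unfolding im stemmed_def by blast
  moreover have "stem_quad (g a) \<in> (`) ?f ` B" if "a \<in> L" for a
    using S that by (auto simp: stemmed_def simp flip: sp)
  moreover have "stem_quad (g a) \<in> ?K (?f p) (g a)" if "a \<in> L" "p \<in> stem_quad a" for a p
  proof -
    have "stem_quad a \<in> K p a" using S that by (auto simp: stemmed_def)
    then have "?f ` stem_quad a \<in> (`) ?f ` K p a" by (rule imageI)
    moreover have "inv_into (stem_points L) ?f (?f p) = p" "inv_into L g (g a) = a"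
      using inv[OF that(2,1)] g that(1) by simp_all
    ultimately show ?thesis by (simp only: sp)
  qed
  ultimately have "stemmed (g ` L) ((`) ?f ` B) ?K"
    unfolding stemmed_def by (auto simp only: ball_simps(9) sp[symmetric])
  then show ?thesis by blast
qed

section \<open>Linear spaces with a stemmed system on every line\<close>

definition collinear :: "'v set set \<Rightarrow> 'v \<Rightarrow> 'v \<Rightarrow> 'v \<Rightarrow> bool" where
  "collinear LL x y z \<longleftrightarrow> (\<exists>l\<in>LL. x \<in> l \<and> y \<in> l \<and> z \<in> l)"

lemma UNIV_bit: "(UNIV :: bit set) = {0, 1}"
  using bit_not_one_iff by blast

lemma stems: "finite (range Inr :: 'v stem_pt set)" "card (range Inr :: 'v stem_pt set) = 2"
  by (simp_all add: UNIV_bit)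

lemma ex_Inl_if_distinct:
  assumes "distinct [p, q, r :: 'v stem_pt]" shows "\<exists>v. Inl v \<in> {p, q, r}"
proof (rule ccontr)
  assume "\<nexists>v. Inl v \<in> {p, q, r}"
  then have "{p, q, r} \<subseteq> range Inr" by (cases p; cases q; cases r) auto
  from card_mono[OF stems(1) this] assms show False by (simp add: stems(2))
qed

text \<open>\<open>H\<close> supplies the blocks over non-collinear triples, \<open>M p c\<close>
  the part of class \<open>c\<close> at \<open>p\<close> off the line through \<open>fst p\<close>
  and \<open>c\<close>. By \<open>line_ex\<close> a triple with a repeated point is collinear, so
  \<open>M_col\<close> leaves no block in \<open>M p c\<close> when
  \<open>c = fst p\<close>.\<close>

locale stem_glue =
  fixes V :: "'v set" and LL :: "'v set set"
    and Bl :: "'v set \<Rightarrow> 'v stem_pt set set"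
    and Kl :: "'v set \<Rightarrow> 'v stem_pt \<Rightarrow> 'v \<Rightarrow> 'v stem_pt set set"
    and H :: "('v \<times> bit) set set" and M :: "'v \<times> bit \<Rightarrow> 'v \<Rightarrow> ('v \<times> bit) set set"
  assumes line_sub: "l \<in> LL \<Longrightarrow> l \<subseteq> V"
    and line_ex: "\<lbrakk>x \<in> V; y \<in> V\<rbrakk> \<Longrightarrow> \<exists>l\<in>LL. x \<in> l \<and> y \<in> l"
    and line_unique: "\<lbrakk>l \<in> LL; m \<in> LL; x \<in> l; x \<in> m; y \<in> l; y \<in> m; x \<noteq> y\<rbrakk> \<Longrightarrow> l = m"
    and line_stemmed: "l \<in> LL \<Longrightarrow> stemmed l (Bl l) (Kl l)"
    and H_sub: "b \<in> H \<Longrightarrow> b \<subseteq> V \<times> UNIV \<and> card b = 4"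
    and H_col: "\<lbrakk>b \<in> H; p \<in> b; q \<in> b; r \<in> b; distinct [p, q, r]\<rbrakk> \<Longrightarrow> \<not> collinear LL (fst p) (fst q) (fst r)"
    and H_ex1: "\<lbrakk>fst p \<in> V; fst q \<in> V; fst r \<in> V; \<not> collinear LL (fst p) (fst q) (fst r)\<rbrakk> \<Longrightarrow>
          \<exists>!b. b \<in> H \<and> p \<in> b \<and> q \<in> b \<and> r \<in> b"
    and M_sub: "\<lbrakk>fst p \<in> V; c \<in> V\<rbrakk> \<Longrightarrow> M p c \<subseteq> {b \<in> H. p \<in> b}"
    and M_col: "\<lbrakk>fst p \<in> V; c \<in> V; b \<in> M p c; q \<in> b; q \<noteq> p\<rbrakk> \<Longrightarrow> \<not> collinear LL (fst p) c (fst q)"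
    and M_ex1: "\<lbrakk>fst p \<in> V; fst q \<in> V; c \<in> V; \<not> collinear LL (fst p) c (fst q)\<rbrakk> \<Longrightarrow> \<exists>!b. b \<in> M p c \<and> q \<in> b"
    and M_colour: "\<lbrakk>b \<in> H; p \<in> b\<rbrakk> \<Longrightarrow> \<exists>!c. c \<in> V \<and> b \<in> M p c"
begin

definition "glued_blocks = \<Union> (Bl ` LL) \<union> (`) Inl ` H"

text \<open>One formula for three cases: at a stem, or when \<open>p\<close> lies over
  \<open>c\<close>, all lines through \<open>c\<close> contribute; otherwise only the line joining
  \<open>c\<close> to the projection of \<open>p\<close> does, together with
  \<open>M\<close>.\<close>

definition "glued_classes p c = \<Union> {Kl l p c | l. l \<in> LL \<and> c \<in> l \<and> p \<in> stem_points l} \<union>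
   (case p of Inl v \<Rightarrow> (`) Inl ` M v c | Inr _ \<Rightarrow> {})"

lemma line_part:
  assumes "l \<in> LL"
  shows "b \<in> Bl l \<Longrightarrow> b \<subseteq> stem_points l" "b \<in> Bl l \<Longrightarrow> card b = 4"
    and "\<lbrakk>p \<in> stem_points l; q \<in> stem_points l; r \<in> stem_points l; distinct [p, q, r]\<rbrakk> \<Longrightarrow> \<exists>!b. b \<in> Bl l \<and> p \<in> b \<and> q \<in> b \<and> r \<in> b"
    and "\<lbrakk>b \<in> Kl l p c; p \<in> stem_points l; c \<in> l\<rbrakk> \<Longrightarrow> b \<in> Bl l \<and> p \<in> b"
    and "\<lbrakk>p \<in> stem_points l; b \<in> Bl l; p \<in> b\<rbrakk> \<Longrightarrow> \<exists>!c. c \<in> l \<and> b \<in> Kl l p c"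
    and "\<lbrakk>p \<in> stem_points l; q \<in> stem_points l; c \<in> l; p \<noteq> q\<rbrakk> \<Longrightarrow> \<exists>!b. b \<in> Kl l p c \<and> q \<in> b"
    and "a \<in> l \<Longrightarrow> stem_quad a \<in> Bl l" and "\<lbrakk>a \<in> l; p \<in> stem_quad a\<rbrakk> \<Longrightarrow> stem_quad a \<in> Kl l p a"
proof -
  have S: "coloured_SQS (stem_points l) (Bl l) l (Kl l)"
    using line_stemmed[OF assms] by (simp add: stemmed_def)
  note D = coloured_SQSD[OF S]
  show "b \<in> Bl l \<Longrightarrow> b \<subseteq> stem_points l" "b \<in> Bl l \<Longrightarrow> card b = 4"
    by (fact D)+
  show "\<lbrakk>p \<in> stem_points l; q \<in> stem_points l; r \<in> stem_points l; distinct [p, q, r]\<rbrakk> \<Longrightarrow> \<exists>!b. b \<in> Bl l \<and> p \<in> b \<and> q \<in> b \<and> r \<in> b"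
    by (fact D)
  show "\<lbrakk>b \<in> Kl l p c; p \<in> stem_points l; c \<in> l\<rbrakk> \<Longrightarrow> b \<in> Bl l \<and> p \<in> b"
    using D(4,5) by simp
  show "\<lbrakk>p \<in> stem_points l; b \<in> Bl l; p \<in> b\<rbrakk> \<Longrightarrow> \<exists>!c. c \<in> l \<and> b \<in> Kl l p c"
    by (fact D)
  show "\<lbrakk>p \<in> stem_points l; q \<in> stem_points l; c \<in> l; p \<noteq> q\<rbrakk> \<Longrightarrow> \<exists>!b. b \<in> Kl l p c \<and> q \<in> b"
    by (fact D)
  show "a \<in> l \<Longrightarrow> stem_quad a \<in> Bl l" "\<lbrakk>a \<in> l; p \<in> stem_quad a\<rbrakk> \<Longrightarrow> stem_quad a \<in> Kl l p a"
    using line_stemmed[OF assms] by (auto simp: stemmed_def)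
qed

lemma stem_points_inter:
  assumes "l \<in> LL" "m \<in> LL" "l \<noteq> m" "a \<in> l" "a \<in> m"
  shows "stem_points l \<inter> stem_points m \<subseteq> stem_quad a"
proof
  fix p assume "p \<in> stem_points l \<inter> stem_points m"
  then show "p \<in> stem_quad a"
    using line_unique[OF assms(1,2,4,5)] assms(3) by (cases p) auto
qed

lemma card_stem_quad: "card (stem_quad a) = 4"
  by (simp add: stem_quad_def)

text \<open>Three of the four points would already be collinear, against
  \<open>H_col\<close>.\<close>

lemma H_not_on_line:
  assumes "b \<in> H" "l \<in> LL"
  shows "\<not> Inl ` b \<subseteq> stem_points l"
proof
  assume sub: "Inl ` b \<subseteq> stem_points l"
  have "card b = 4" using H_sub assms by blast
  then obtain T where "T \<subseteq> b" "card T = 3"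
    using obtain_subset_with_card_n[of 3 b] by auto
  then obtain p q r where "p \<in> b" "q \<in> b" "r \<in> b" "distinct [p, q, r]"
    unfolding card_3_iff by auto
  then show False
    using H_col[OF assms(1)] sub assms(2) unfolding collinear_def image_subset_iff Inl_mem_stem_points by metis
qed

text \<open>Four points include one that is not a stem, so the lines meet in its projection
  \<open>a\<close>. They meet nowhere else, which confines the block to
  \<open>stem_quad a\<close>.\<close>

lemma common_block:
  assumes "l \<in> LL" "m \<in> LL" "l \<noteq> m" "b \<in> Bl l" "b \<in> Bl m"
  obtains a where "b = stem_quad a" "a \<in> l" "a \<in> m"
proof -
  have b: "b \<subseteq> stem_points l \<inter> stem_points m" "card b = 4" using line_part assms by blast+
  have "\<not> b \<subseteq> range Inr"
  proof
    assume *: "b \<subseteq> range Inr"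
    from card_mono[OF stems(1) *] b(2) show False by (simp add: stems(2))
  qed
  then obtain p where "p \<in> b" "p \<notin> range Inr" by blast
  then obtain v where v: "Inl v \<in> b" by (cases p) auto
  then have "fst v \<in> l" "fst v \<in> m" using b(1) by auto
  moreover from this have "b \<subseteq> stem_quad (fst v)" using stem_points_inter assms b(1) by blast
  then have "b = stem_quad (fst v)"
    using card_subset_eq[of "stem_quad (fst v)" b] b(2) by (simp add: card_stem_quad) (simp add: stem_quad_def)
  ultimately show ?thesis using that by blast
qed

lemma stemmed_glue: "stemmed V glued_blocks glued_classes"
  unfolding stemmed_def coloured_SQS_def
proof (intro conjI ballI impI)
  fix b assume "b \<in> glued_blocks"
  then consider l where "l \<in> LL" "b \<in> Bl l" | h where "h \<in> H" "b = Inl ` h" unfolding glued_blocks_def by blast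
  then show "b \<subseteq> stem_points V" "card b = 4"
  proof (atomize(full), cases)
    case 1
    then have "b \<subseteq> stem_points l" "card b = 4" using line_part by blast+
    moreover have "stem_points l \<subseteq> stem_points V" using line_sub[OF 1(1)] unfolding stem_points_def by blast
    ultimately show "b \<subseteq> stem_points V \<and> card b = 4" by blast
  next
    case 2
    then show "b \<subseteq> stem_points V \<and> card b = 4" using H_sub[OF 2(1)] by (auto simp: card_image)
  qed
next
  fix p q r assume X: "p \<in> stem_points V" "q \<in> stem_points V" "r \<in> stem_points V" and d: "distinct [p, q, r]"
  show "\<exists>!b. b \<in> glued_blocks \<and> p \<in> b \<and> q \<in> b \<and> r \<in> b"
  \<comment> \<open>Either the triple lies over one line, or it contains no stem and its projections
    are non-collinear.\<close>
  proof (cases "\<exists>l\<in>LL. p \<in> stem_points l \<and> q \<in> stem_points l \<and> r \<in> stem_points l")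
    case True
    then obtain l where l: "l \<in> LL" "p \<in> stem_points l" "q \<in> stem_points l" "r \<in> stem_points l" by blast
    obtain b where b: "b \<in> Bl l" "p \<in> b" "q \<in> b" "r \<in> b"
      and u: "\<And>d. \<lbrakk>d \<in> Bl l; p \<in> d; q \<in> d; r \<in> d\<rbrakk> \<Longrightarrow> d = b"
      using line_part(3)[OF l d] by metis
    show ?thesis
    proof (rule ex1I[of _ b])
      show "b \<in> glued_blocks \<and> p \<in> b \<and> q \<in> b \<and> r \<in> b" using b l by (auto simp: glued_blocks_def)
      fix e assume e: "e \<in> glued_blocks \<and> p \<in> e \<and> q \<in> e \<and> r \<in> e"
      then consider m where "m \<in> LL" "e \<in> Bl m" | h where "h \<in> H" "e = Inl ` h" unfolding glued_blocks_def by blast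
      then show "e = b"
      proof cases
        case 1
        show ?thesis
        proof (cases "m = l")
          case True
          then show ?thesis using u e 1 by blast
        next
          case False
          have m: "p \<in> stem_points m" "q \<in> stem_points m" "r \<in> stem_points m" using line_part(1)[OF 1] e by blast+
          \<comment> \<open>Two stems cannot fill a triple, so some point of it projects to the
            common point of \<open>l\<close> and \<open>m\<close>. All three then lie in its
            \<open>stem_quad\<close>, which is a block of both copies.\<close>
          obtain v where "Inl v \<in> {p, q, r}" using ex_Inl_if_distinct[OF d] ..
          then have v: "fst v \<in> l" "fst v \<in> m" using l m by (metis Inl_mem_stem_points insertE empty_iff)+
          have sp: "p \<in> stem_quad (fst v)" "q \<in> stem_quad (fst v)" "r \<in> stem_quad (fst v)"
            using stem_points_inter[OF l(1) 1(1) _ v] False l m by blast+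
          then have "stem_quad (fst v) = b" using u line_part(7)[OF l(1) v(1)] by blast
          moreover have "stem_quad (fst v) = e"
            using line_part(3)[OF 1(1) m d] line_part(7)[OF 1(1) v(2)] sp e 1(2) by blast
          ultimately show ?thesis by simp
        qed
      next
        case 2
        then obtain p' q' r' where "p = Inl p'" "q = Inl q'" "r = Inl r'" "p' \<in> h" "q' \<in> h" "r' \<in> h"
          using e by blast
        then show ?thesis using H_col[OF 2(1), of p' q' r'] d l unfolding collinear_def by auto
      qed
    qed
  next
    case False
    have "\<exists>p' q' r'. p = Inl p' \<and> q = Inl q' \<and> r = Inl r'"
    proof -
      have "\<exists>l\<in>LL. p \<in> stem_points l \<and> q \<in> stem_points l \<and> r \<in> stem_points l" if "x \<in> range Inr" "x \<in> {p, q, r}" for x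
      proof -
        obtain v where "Inl v \<in> {p, q, r}" using ex_Inl_if_distinct[OF d] ..
        then obtain y where y: "y \<in> V" using X by fastforce
        \<comment> \<open>\<open>w\<close> projects to \<open>V\<close>, with the arbitrary value
          \<open>y\<close> at stems. Once one point is a stem, a line through the projections of the
          other two carries the whole triple.\<close>
        define w where "w s = (case s of Inl v \<Rightarrow> fst v | Inr _ \<Rightarrow> y)" for s :: "'v stem_pt"
        have w: "w s \<in> V" "s \<in> stem_points l \<longleftrightarrow> s \<in> range Inr \<or> w s \<in> l" if "s \<in> stem_points V" for s l
          using that y by (cases s; auto simp: w_def)+
        from that(2) show ?thesis
          using that(1) X w line_ex by (elim insertE emptyE) (metis w)+
      qed
      then show ?thesis using False by (cases p; cases q; cases r) auto
    qed
    then obtain p' q' r' where p: "p = Inl p'" "q = Inl q'" "r = Inl r'" by blast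
    then have nc: "\<not> collinear LL (fst p') (fst q') (fst r')" using False by (auto simp: collinear_def)
    obtain h where h: "h \<in> H" "p' \<in> h" "q' \<in> h" "r' \<in> h"
      and u: "\<And>d. \<lbrakk>d \<in> H; p' \<in> d; q' \<in> d; r' \<in> d\<rbrakk> \<Longrightarrow> d = h"
      using H_ex1[OF _ _ _ nc] X p by (metis Inl_mem_stem_points)
    show ?thesis
    proof (rule ex1I[of _ "Inl ` h"])
      show "Inl ` h \<in> glued_blocks \<and> p \<in> Inl ` h \<and> q \<in> Inl ` h \<and> r \<in> Inl ` h"
        using h p by (auto simp: glued_blocks_def)
      fix e assume e: "e \<in> glued_blocks \<and> p \<in> e \<and> q \<in> e \<and> r \<in> e"
      then show "e = Inl ` h"
        using False u line_part(1) unfolding glued_blocks_def p by blast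
    qed
  qed
next
  fix p c assume p: "p \<in> stem_points V" "c \<in> V"
  show "glued_classes p c \<subseteq> {b \<in> glued_blocks. p \<in> b}"
  proof
    fix b assume "b \<in> glued_classes p c"
    then consider m where "m \<in> LL" "c \<in> m" "p \<in> stem_points m" "b \<in> Kl m p c"
      | v h where "p = Inl v" "b = Inl ` h" "h \<in> M v c"
      unfolding glued_classes_def by (cases p) auto
    then show "b \<in> {b \<in> glued_blocks. p \<in> b}"
    proof cases
      case 1
      then show ?thesis using line_part(4)[OF 1(1,4,3,2)] by (auto simp: glued_blocks_def)
    next
      case 2
      then show ?thesis using M_sub[of v c] p by (auto simp: glued_blocks_def)
    qed
  qed
next
  fix p b assume p: "p \<in> stem_points V" "b \<in> glued_blocks" "p \<in> b"
  have K_line: "(\<exists>m\<in>LL. c \<in> m \<and> p \<in> stem_points m \<and> b \<in> Kl m p c) \<or> (\<exists>v h. p = Inl v \<and> b = Inl ` h \<and> h \<in> M v c)"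
    if "b \<in> glued_classes p c" for c
    using that unfolding glued_classes_def by (cases p) auto
  from p consider l where "l \<in> LL" "b \<in> Bl l" | h where "h \<in> H" "b = Inl ` h" unfolding glued_blocks_def by blast
  then show "\<exists>!c. c \<in> V \<and> b \<in> glued_classes p c"
  proof cases
    case 1
    then have pl: "p \<in> stem_points l" using line_part(1) p by blast
    obtain c where c: "c \<in> l" "b \<in> Kl l p c" and u: "\<And>d. \<lbrakk>d \<in> l; b \<in> Kl l p d\<rbrakk> \<Longrightarrow> d = c"
      using line_part(5)[OF 1(1) pl 1(2) p(3)] by metis
    show ?thesis
    proof (rule ex1I[of _ c])
      show "c \<in> V \<and> b \<in> glued_classes p c" using c 1 pl line_sub unfolding glued_classes_def by blast
      fix d assume d: "d \<in> V \<and> b \<in> glued_classes p d"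
      from K_line[of d] d
      consider m where "m \<in> LL" "d \<in> m" "p \<in> stem_points m" "b \<in> Kl m p d"
        | v h where "p = Inl v" "b = Inl ` h" "h \<in> M v d" by blast
      then show "d = c"
      proof cases
        case m: 1
        have bm: "b \<in> Bl m" using line_part(4)[OF m(1)] m by blast
        show ?thesis
        proof (cases "m = l")
          case True
          then show ?thesis using u m by blast
        next
          case False
          \<comment> \<open>A block occurring on two lines is a \<open>stem_quad\<close>, and its
            label is \<open>a\<close> on either line.\<close>
          obtain a where a: "b = stem_quad a" "a \<in> l" "a \<in> m"
            using common_block[OF 1(1) m(1) _ 1(2) bm] False by metis
          have "stem_quad a \<in> Kl l p a" "stem_quad a \<in> Kl m p a"
            using line_part(8) 1(1) m(1) a p(3) by blast+
          then have "a = c" "a = d"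
            using u a line_part(5)[OF m(1) m(3) bm p(3)] m by blast+
          then show ?thesis by simp
        qed
      next
        case 2
        then have "h \<in> H" using M_sub[of v d] d p by auto
        then show ?thesis using H_not_on_line[OF _ 1(1)] line_part(1)[OF 1] 2 by blast
      qed
    qed
  next
    case 2
    then obtain v where v: "p = Inl v" "v \<in> h" using p by blast
    obtain c where c: "c \<in> V" "h \<in> M v c" and u: "\<And>d. \<lbrakk>d \<in> V; h \<in> M v d\<rbrakk> \<Longrightarrow> d = c"
      using M_colour[OF 2(1) v(2)] by metis
    show ?thesis
    proof (rule ex1I[of _ c])
      show "c \<in> V \<and> b \<in> glued_classes p c" using c 2 v unfolding glued_classes_def by auto
      fix d assume d: "d \<in> V \<and> b \<in> glued_classes p d"
      then have "\<not> (\<exists>m\<in>LL. d \<in> m \<and> p \<in> stem_points m \<and> b \<in> Kl m p d)"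
        using H_not_on_line[OF 2(1)] line_part(1,4) 2(2) by metis
      then obtain h' where "b = Inl ` h'" "h' \<in> M v d" using K_line[of d] d v by blast
      then have "h \<in> M v d" using 2(2) by (simp add: inj_image_eq_iff)
      then show "d = c" using u d by blast
    qed
  qed
next
  fix p q c assume p: "p \<in> stem_points V" "q \<in> stem_points V" and c: "c \<in> V" and "p \<noteq> q"
  show "\<exists>!b. b \<in> glued_classes p c \<and> q \<in> b"
  proof (cases "\<exists>l\<in>LL. c \<in> l \<and> p \<in> stem_points l \<and> q \<in> stem_points l")
    case True
    then obtain l where l: "l \<in> LL" "c \<in> l" "p \<in> stem_points l" "q \<in> stem_points l" by blast
    obtain b where b: "b \<in> Kl l p c" "q \<in> b" and u: "\<And>d. \<lbrakk>d \<in> Kl l p c; q \<in> d\<rbrakk> \<Longrightarrow> d = b"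
      using line_part(6)[OF l(1,3,4,2) \<open>p \<noteq> q\<close>] by metis
    show ?thesis
    proof (rule ex1I[of _ b])
      show "b \<in> glued_classes p c \<and> q \<in> b" using b l unfolding glued_classes_def by blast
      fix e assume e: "e \<in> glued_classes p c \<and> q \<in> e"
      then consider m where "m \<in> LL" "c \<in> m" "p \<in> stem_points m" "e \<in> Kl m p c"
        | v h where "p = Inl v" "e = Inl ` h" "h \<in> M v c"
        unfolding glued_classes_def by (cases p) auto
      then show "e = b"
      proof cases
        case 1
        have qm: "q \<in> stem_points m" using line_part(1,4) 1 e by blast
        show ?thesis
        proof (cases "m = l")
          case True
          then show ?thesis using u e 1 by blast
        next
          case False
          \<comment> \<open>Both lines pass through \<open>c\<close> and meet only there, so
            \<open>stem_quad c\<close> contains \<open>p\<close> and \<open>q\<close>; it has label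
            \<open>c\<close> at \<open>p\<close> in both copies.\<close>
          then have sp: "p \<in> stem_quad c" "q \<in> stem_quad c"
            using stem_points_inter[OF l(1) 1(1) _ l(2) 1(2)] l 1 qm by blast+
          then have "stem_quad c = b" using u line_part(8) l by blast
          moreover have "stem_quad c = e"
            using line_part(6)[OF 1(1,3) qm 1(2) \<open>p \<noteq> q\<close>] line_part(8)[OF 1(1,2) sp(1)] sp e 1 by blast
          ultimately show ?thesis by simp
        qed
      next
        case 2
        then obtain w where "q = Inl w" "w \<in> h" using e by blast
        then show ?thesis using M_col[of v c h w] 2 p c l \<open>p \<noteq> q\<close> unfolding collinear_def by auto
      qed
    qed
  next
    case False
    \<comment> \<open>A stem lies over every line, so if one of the two were a stem, a line through
      \<open>c\<close> and the other would contradict \<open>False\<close>.\<close>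
    obtain v w where v: "p = Inl v" "q = Inl w"
    proof -
      have "\<exists>l\<in>LL. c \<in> l \<and> p \<in> stem_points l \<and> q \<in> stem_points l" if "p \<in> range Inr \<or> q \<in> range Inr"
        using that p c line_ex[OF c] by (cases p; cases q) force+
      then show thesis using False that by (cases p; cases q) auto
    qed
    then have nc: "\<not> collinear LL (fst v) c (fst w)" using False by (auto simp: collinear_def)
    obtain h where h: "h \<in> M v c" "w \<in> h" and u: "\<And>d. \<lbrakk>d \<in> M v c; w \<in> d\<rbrakk> \<Longrightarrow> d = h"
      using M_ex1[OF _ _ c nc] p v by (metis Inl_mem_stem_points)
    show ?thesis
    proof (rule ex1I[of _ "Inl ` h"])
      show "Inl ` h \<in> glued_classes p c \<and> q \<in> Inl ` h" using h v unfolding glued_classes_def by auto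
      fix e assume e: "e \<in> glued_classes p c \<and> q \<in> e"
      then have "\<not> (\<exists>m\<in>LL. c \<in> m \<and> p \<in> stem_points m \<and> e \<in> Kl m p c)"
        using False line_part(1) line_part(4) by (meson subsetD)
      then show "e = Inl ` h" using u e v unfolding glued_classes_def by auto
    qed
  qed
next
  fix a assume a: "a \<in> V"
  obtain l where l: "l \<in> LL" "a \<in> l" using line_ex a by blast
  then show "stem_quad a \<in> glued_blocks" using line_part(7) unfolding glued_blocks_def by blast
  fix p assume p: "p \<in> stem_quad a"
  then have "p \<in> stem_points l" using l by (cases p) auto
  then show "stem_quad a \<in> glued_classes p a" using l line_part(8) p unfolding glued_classes_def by blast
qed

end

section \<open>Vector spaces over the field with four elements\<close>

text \<open>The pair \<open>(a, b)\<close> encodes \<open>a + b\<omega>\<close> with \<open>\<omega>\<^sup>2 = \<omega> + 1\<close>, and \<open>om\<close> is multiplication by \<open>\<omega>\<close>. A vector space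
  is given by the action \<open>w\<close> of \<open>\<omega>\<close> on an additive group.\<close>

type_synonym f4 = "bit \<times> bit"

definition f4_list :: "f4 list" where "f4_list = [(0, 0), (1, 0), (0, 1), (1, 1)]"

fun om :: "f4 \<Rightarrow> f4" where "om (a, b) = (b, a + b)"

text \<open>The element with coefficients a, b acts as ax + b\<open>w\<close>(x); the bits are
  resolved by cases because the vectors carry only a group structure.\<close>

definition scal :: "('v \<Rightarrow> 'v) \<Rightarrow> f4 \<Rightarrow> 'v \<Rightarrow> 'v::ab_group_add" where
  "scal w a x = (if fst a = 1 then x else 0) + (if snd a = 1 then w x else 0)"

text \<open>The explicit list of scalars lets \<open>indep\<close> be evaluated in the finite
  checks.\<close>

definition span1 :: "('v \<Rightarrow> 'v) \<Rightarrow> 'v \<Rightarrow> 'v::ab_group_add set" where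
  "span1 w d = set (map (\<lambda>a. scal w a d) f4_list)"

definition indep :: "('v \<Rightarrow> 'v) \<Rightarrow> 'v \<Rightarrow> 'v::ab_group_add \<Rightarrow> bool" where
  "indep w y z \<longleftrightarrow> y \<noteq> 0 \<and> z \<notin> span1 w y"

lemma om_add: "om (x + y) = om x + om y"
  by (cases x; cases y) (simp only: add_Pair om.simps add_ac)

lemma om_om: "om (om x) = om x + x"
  by (cases x) (simp only: add_Pair om.simps add_ac)

lemma set_f4_list [simp]: "set f4_list = UNIV"
  by (auto simp: f4_list_def)

lemma bit_add_self [simp]: "(a :: bit) + a = 0"
  by (cases a) simp_all

lemma span1_iff: "x \<in> span1 w d \<longleftrightarrow> (\<exists>a. x = scal w a d)"
  by (auto simp: span1_def)

text \<open>The product of the encoded elements, reduced by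
  \<open>\<omega>\<^sup>2 = \<omega> + 1\<close>.\<close>

definition f4_times :: "f4 \<Rightarrow> f4 \<Rightarrow> f4" where
  "f4_times a b = (fst a * fst b + snd a * snd b, fst a * snd b + snd a * fst b + snd a * snd b)"

lemma f4_inverse_ex: "a \<noteq> 0 \<Longrightarrow> \<exists>b. f4_times b a = (1, 0)"
proof -
  assume "a \<noteq> 0"
  moreover have "a \<in> set f4_list" by simp
  ultimately have "a = (1, 0) \<or> a = (0, 1) \<or> a = (1, 1)" by (auto simp: f4_list_def zero_prod_def)
  then have "f4_times (1, 0) a = (1, 0) \<or> f4_times (1, 1) a = (1, 0) \<or> f4_times (0, 1) a = (1, 0)"
    by (auto simp: f4_times_def)
  then show ?thesis by blast
qed

text \<open>The space is a subset \<open>V\<close> of a type on which the field acts, because its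
  dimension will be a variable.\<close>

locale f4_space =
  fixes w :: "'v::ab_group_add \<Rightarrow> 'v" and V :: "'v set"
  assumes add_self: "(x :: 'v) + x = 0"
    and w_add: "w (x + y) = w x + w y"
    and w_w: "w (w x) = w x + x"
    and zero_mem: "0 \<in> V"
    and add_mem: "\<lbrakk>x \<in> V; y \<in> V\<rbrakk> \<Longrightarrow> x + y \<in> V"
    and w_mem: "x \<in> V \<Longrightarrow> w x \<in> V"
begin

lemma add_self_left: "(x :: 'v) + (x + y) = y"
proof -
  have "x + (x + y) = (x + x) + y" by (simp only: add.assoc)
  then show ?thesis by (simp only: add_self add_0)
qed

lemmas cancel = add_self add_self_left

lemma add_eq_iff: "(x :: 'v) + y = z \<longleftrightarrow> y = x + z"
  using add_self_left by auto

lemma add_eq_0_iff: "(x :: 'v) + y = 0 \<longleftrightarrow> x = y"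
  unfolding add_eq_iff by auto

lemma w_0 [simp]: "w 0 = 0"
  using w_add[of 0 0] by simp

lemma scal_zero [simp]: "scal w 0 x = 0" "scal w a 0 = 0" "scal w (0, 0) x = 0" "scal w (1, 0) x = x"
  by (simp_all add: scal_def)

lemma scal_mem: "x \<in> V \<Longrightarrow> scal w a x \<in> V"
  by (simp add: scal_def add_mem w_mem zero_mem)

lemma scal_add_right: "scal w a (x + y) = scal w a x + scal w a y"
  by (simp add: scal_def w_add add_ac)

lemma scal_add_left: "scal w (a + b) x = scal w a x + scal w b x"
  by (cases a; cases b; cases "fst a"; cases "snd a"; cases "fst b"; cases "snd b")
     (simp_all add: scal_def add_ac cancel)

lemma scal_scal: "scal w a (scal w b x) = scal w (f4_times a b) x"
  by (cases a; cases b; cases "fst a"; cases "snd a"; cases "fst b"; cases "snd b")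
     (simp_all add: scal_def f4_times_def w_add w_w add_ac cancel)

lemma scal_cancel:
  assumes "a \<noteq> 0" obtains b where "\<And>x. scal w b (scal w a x) = x"
proof -
  obtain b where b: "f4_times b a = (1, 0)" using f4_inverse_ex assms by blast
  have "scal w b (scal w a x) = x" for x
    by (simp add: scal_scal b)
  then show ?thesis by (rule that)
qed

lemma scal_eq_0_iff: "scal w a x = 0 \<longleftrightarrow> a = 0 \<or> x = 0"
  by (metis scal_cancel scal_zero(1,2))

lemma span1_zero: "0 \<in> span1 w d" and span1_self: "d \<in> span1 w d"
  unfolding span1_iff using scal_zero by metis+

lemma span1_add: "\<lbrakk>x \<in> span1 w d; y \<in> span1 w d\<rbrakk> \<Longrightarrow> x + y \<in> span1 w d"
  unfolding span1_iff using scal_add_left by metis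

lemma span1_scal: "x \<in> span1 w d \<Longrightarrow> scal w a x \<in> span1 w d"
  unfolding span1_iff using scal_scal by metis

lemma span1_mem: "\<lbrakk>d \<in> V; x \<in> span1 w d\<rbrakk> \<Longrightarrow> x \<in> V"
  unfolding span1_iff using scal_mem by auto

text \<open>Nonzero scalars are invertible, so \<open>d\<close> is in turn a multiple of
  \<open>x\<close>.\<close>

lemma span1_eq: "\<lbrakk>x \<in> span1 w d; x \<noteq> 0\<rbrakk> \<Longrightarrow> span1 w x = span1 w d"
proof -
  assume x: "x \<in> span1 w d" "x \<noteq> 0"
  then obtain a where a: "x = scal w a d" by (auto simp: span1_iff)
  with x have "a \<noteq> 0" by auto
  then obtain b where b: "d = scal w b x" using a scal_cancel by metis
  show ?thesis
  proof (intro subset_antisym subsetI)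
    fix y assume "y \<in> span1 w x"
    then show "y \<in> span1 w d" using span1_scal[OF x(1)] by (auto simp: span1_iff[of y w x])
  next
    fix y assume "y \<in> span1 w d"
    then obtain c where "y = scal w c d" by (auto simp: span1_iff)
    then show "y \<in> span1 w x" unfolding b by (simp only: span1_scal span1_self)
  qed
qed

text \<open>Exchange: if \<open>y\<close> were in the span of \<open>z\<close>, the two spans would
  agree by \<open>span1_eq\<close>, and the span of \<open>y\<close> would contain
  \<open>z\<close>.\<close>

lemma indep_sym: "indep w y z \<Longrightarrow> indep w z y"
  unfolding indep_def using span1_eq span1_self span1_zero by metis

lemma indep_neq: "indep w y z \<Longrightarrow> y \<noteq> z"
  using span1_self by (auto simp only: indep_def)

lemma indep_add: "indep w y z \<Longrightarrow> indep w y (y + z)"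
  unfolding indep_def using span1_add span1_self add_self_left by metis

section \<open>Two-dimensional subspaces in coordinates\<close>

definition comb :: "'v \<Rightarrow> 'v \<Rightarrow> f4 \<times> f4 \<Rightarrow> 'v" where
  "comb e f u = scal w (fst u) e + scal w (snd u) f"

definition plane :: "'v \<Rightarrow> 'v \<Rightarrow> 'v set" where "plane e f = range (comb e f)"

lemma comb_add: "comb e f (u + v) = comb e f u + comb e f v"
  by (simp add: comb_def scal_add_left add_ac)

lemma comb_mem: "\<lbrakk>e \<in> V; f \<in> V\<rbrakk> \<Longrightarrow> comb e f u \<in> V"
  by (simp add: comb_def add_mem scal_mem)

lemma comb_scal: "comb e f (f4_times a (fst u), f4_times a (snd u)) = scal w a (comb e f u)"
  by (simp add: comb_def scal_add_right scal_scal)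

lemma comb_eq_0:
  assumes "indep w e f" "comb e f u = 0" shows "u = 0"
proof -
  have eq: "scal w (fst u) e = scal w (snd u) f"
    using assms(2) by (simp add: comb_def add_eq_0_iff)
  have "snd u = 0"
  proof (rule ccontr)
    assume "snd u \<noteq> 0"
    then obtain b where "\<And>x. scal w b (scal w (snd u) x) = x" using scal_cancel by metis
    then have "f = scal w b (scal w (fst u) e)" by (simp add: eq)
    then have "f \<in> span1 w e" using span1_scal span1_self by metis
    with assms(1) show False by (simp add: indep_def)
  qed
  with eq assms(1) have "fst u = 0" by (simp add: scal_eq_0_iff indep_def)
  with \<open>snd u = 0\<close> show ?thesis by (simp add: prod_eq_iff)
qed

lemma inj_comb:
  assumes "indep w e f" shows "inj (comb e f)"
proof (rule injI)
  fix u v assume "comb e f u = comb e f v"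
  then have "comb e f (u + v) = 0" by (simp add: comb_add add_self)
  then have "u + v = 0" by (rule comb_eq_0[OF assms])
  moreover have "v + v = 0" by (simp add: prod_eq_iff)
  ultimately show "u = v" by (metis add.commute add_left_cancel)
qed

lemma plane_closed:
  assumes "y \<in> plane e f" "z \<in> plane e f" shows "plane y z \<subseteq> plane e f"
proof
  fix x assume "x \<in> plane y z"
  then obtain v where x: "x = scal w (fst v) y + scal w (snd v) z" by (auto simp: plane_def comb_def)
  obtain s t where "y = comb e f s" "z = comb e f t" using assms by (auto simp: plane_def)
  with x have "x = comb e f ((f4_times (fst v) (fst s), f4_times (fst v) (snd s)) +
     (f4_times (snd v) (fst t), f4_times (snd v) (snd t)))"
    by (simp only: comb_add comb_scal)
  then show "x \<in> plane e f" by (auto simp: plane_def)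
qed

text \<open>Both planes have 16 elements, as \<open>comb\<close> is injective on independent
  vectors, so the inclusion from \<open>plane_closed\<close> is an equality.\<close>

lemma plane_eq:
  assumes "y \<in> plane e f" "z \<in> plane e f" "indep w y z" "indep w e f"
  shows "plane y z = plane e f"
proof (rule card_subset_eq[OF _ plane_closed[OF assms(1,2)]])
  have "finite (UNIV :: (f4 \<times> f4) set)" by (simp add: finite_prod UNIV_bit)
  then show "finite (plane e f)" by (simp add: plane_def)
  show "card (plane y z) = card (plane e f)"
    by (simp add: plane_def card_image inj_comb assms)
qed

lemma plane_gen: "e \<in> plane e f" "f \<in> plane e f"
proof -
  have "e = comb e f ((1, 0), 0)" "f = comb e f (0, (1, 0))"
    by (simp_all add: comb_def)
  then show "e \<in> plane e f" "f \<in> plane e f" unfolding plane_def by blast+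
qed

lemma plane_mem: "\<lbrakk>e \<in> V; f \<in> V; x \<in> plane e f\<rbrakk> \<Longrightarrow> x \<in> V"
  using comb_mem by (auto simp: plane_def)

section \<open>Affine lines and collinearity\<close>

definition lines :: "'v set set" where
  "lines = {(+) x ` span1 w d | x d. x \<in> V \<and> d \<in> V \<and> d \<noteq> 0}"

lemma mem_translate: "(y :: 'v) \<in> (+) x ` A \<longleftrightarrow> x + y \<in> A"
proof
  assume "x + y \<in> A"
  then have "x + (x + y) \<in> (+) x ` A" by (rule imageI)
  then show "y \<in> (+) x ` A" by (simp only: add_self_left)
qed (auto simp: add_self_left)

text \<open>In characteristic two \<open>a + b\<close> is a difference of two points, hence a
  direction vector, and any point of a line can be its base. This normal form gives
  \<open>line_unique\<close>.\<close>

lemma line_through: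
  assumes "a \<in> (+) x ` span1 w d" "b \<in> (+) x ` span1 w d" "a \<noteq> b"
  shows "(+) x ` span1 w d = (+) a ` span1 w (a + b)"
proof -
  have ab: "x + a \<in> span1 w d" "x + b \<in> span1 w d" using assms mem_translate by auto
  have "(x + a) + (x + b) = a + b" by (simp add: add_ac cancel)
  with span1_add[OF ab] have "a + b \<in> span1 w d" by (simp only:)
  moreover have "a + b \<noteq> 0" using assms(3) by (simp add: add_eq_0_iff)
  ultimately have eq: "span1 w (a + b) = span1 w d" by (rule span1_eq)
  show ?thesis
  proof (rule set_eqI)
    fix y
    have eqs: "(x + a) + (x + y) = a + y" "(x + a) + (a + y) = x + y"
      by (simp_all add: add_ac cancel)
    have "x + y \<in> span1 w d \<longleftrightarrow> a + y \<in> span1 w d"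
      using span1_add[OF ab(1), of "x + y", unfolded eqs] span1_add[OF ab(1), of "a + y", unfolded eqs]
      by blast
    then show "y \<in> (+) x ` span1 w d \<longleftrightarrow> y \<in> (+) a ` span1 w (a + b)"
      by (simp only: mem_translate eq)
  qed
qed

lemma line_unique:
  assumes "l \<in> lines" "m \<in> lines" "x \<in> l" "x \<in> m" "y \<in> l" "y \<in> m" "x \<noteq> y"
  shows "l = m"
  using assms line_through unfolding lines_def by (smt (verit) mem_Collect_eq)

lemma line_sub: "l \<in> lines \<Longrightarrow> l \<subseteq> V"
  unfolding lines_def using add_mem span1_mem by blast

lemma collinear_iff:
  assumes "x \<in> V" "y \<in> V" "x \<noteq> y"
  shows "collinear lines x y z \<longleftrightarrow> x + z \<in> span1 w (x + y)"
  unfolding collinear_def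
proof
  assume "\<exists>l\<in>lines. x \<in> l \<and> y \<in> l \<and> z \<in> l"
  then obtain v d where "x \<in> (+) v ` span1 w d" "y \<in> (+) v ` span1 w d" "z \<in> (+) v ` span1 w d"
    unfolding lines_def by blast
  then have "z \<in> (+) x ` span1 w (x + y)" using line_through assms(3) by metis
  then show "x + z \<in> span1 w (x + y)" by (simp only: mem_translate)
next
  assume *: "x + z \<in> span1 w (x + y)"
  let ?l = "(+) x ` span1 w (x + y)"
  have "?l \<in> lines" unfolding lines_def using assms add_mem add_eq_0_iff by blast
  moreover have "x \<in> ?l" "y \<in> ?l" "z \<in> ?l"
    using * by (simp_all only: mem_translate add_self span1_zero span1_self)
  ultimately show "\<exists>l\<in>lines. x \<in> l \<and> y \<in> l \<and> z \<in> l" by blast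
qed

lemma line_ex:
  assumes "x \<in> V" "y \<in> V" and nontrivial: "d \<in> V" "d \<noteq> 0"
  shows "\<exists>l\<in>lines. x \<in> l \<and> y \<in> l"
proof (cases "x = y")
  case True
  have "x \<noteq> x + d" "x + d \<in> V" using assms add_mem by auto
  then show ?thesis
    using collinear_iff[of x "x + d" x] assms True add_self span1_zero unfolding collinear_def by fastforce
next
  case False
  then show ?thesis using collinear_iff[of x y y] assms span1_self unfolding collinear_def by fastforce
qed

text \<open>Turns the incidence conditions of \<open>stem_glue\<close> into linear algebra. For
  \<open>x = y\<close> both sides fail: some line joins \<open>x\<close> to \<open>z\<close>, and 0
  belongs to no independent pair.\<close>

lemma not_collinear_iff:
  assumes "x \<in> V" "y \<in> V" and nontrivial: "d \<in> V" "d \<noteq> 0" and "z \<in> V"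
  shows "\<not> collinear lines x y z \<longleftrightarrow> indep w (x + y) (x + z)"
proof (cases "x = y")
  case True
  then show ?thesis using line_ex[OF assms(1) \<open>z \<in> V\<close> nontrivial]
    by (auto simp: indep_def add_self collinear_def)
next
  case False
  then show ?thesis using collinear_iff[OF assms(1,2) False] by (simp add: indep_def add_eq_0_iff)
qed

text \<open>The bijection that moves the SQS(10) over the field onto the line.\<close>

lemma line_param:
  assumes "l \<in> lines"
  obtains g :: "f4 \<Rightarrow> 'v" where "inj g" "range g = l"
proof -
  obtain x d where l: "l = (+) x ` span1 w d" "d \<noteq> 0" using assms by (auto simp: lines_def)
  let ?g = "\<lambda>a. x + scal w a d"
  have "inj ?g"
  proof (rule injI)
    fix a b :: f4 assume "x + scal w a d = x + scal w b d"
    then have "scal w (a + b) d = 0" by (simp add: scal_add_left add_self)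
    then have "a + b = 0" using l(2) by (simp add: scal_eq_0_iff)
    moreover have "b + b = 0" by (simp add: prod_eq_iff)
    ultimately show "a = b" by (metis add.commute add_left_cancel)
  qed
  moreover have "range ?g = l" unfolding l span1_def by auto
  ultimately show ?thesis by (rule that)
qed

end

section \<open>The frame in dimension two\<close>

text \<open>Turns an evaluated count over a list into unique existence.\<close>

lemma length_filter_1E:
  assumes "length (filter P xs) = 1"
  obtains x where "x \<in> set xs" "P x" "\<And>y. \<lbrakk>y \<in> set xs; P y\<rbrakk> \<Longrightarrow> y = x"
proof -
  obtain a where "filter P xs = [a]" using assms by (auto simp: length_Suc_conv)
  then have "x \<in> set xs \<and> P x \<longleftrightarrow> x = a" for x
    using set_filter[of P xs] by auto
  then show ?thesis using that by blast
qed

type_synonym f16 = "f4 \<times> f4"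

fun om2 :: "f16 \<Rightarrow> f16" where "om2 (a, b) = (om a, om b)"

text \<open>The field with 16 elements: \<open>(a, b)\<close> encodes \<open>a + b\<theta>\<close> with \<open>\<theta>\<^sup>2 = \<theta> + \<omega>\<close>. The element \<open>\<theta>\<close> is primitive
  and \<open>\<theta>\<^sup>5 = \<omega>\<close>.\<close>

fun theta :: "f16 \<Rightarrow> f16" where
  "theta (a, b) = (om b, a + b)"

fun theta_pow :: "nat \<Rightarrow> f16" where
  "theta_pow 0 = ((1, 0), 0)"
| "theta_pow (Suc n) = theta (theta_pow n)"

text \<open>An entry \<open>(e, j)\<close> stands for \<open>(\<theta>\<^sup>e, j)\<close>. The three lists are the classes for \<open>1\<close>, \<open>\<omega>\<close> and \<open>\<omega>\<^sup>2\<close>, which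
  miss the subfield with four elements; the other classes arise by multiplication with the powers
  of \<open>\<theta>\<^sup>3\<close>. The table was found with a SAT solver.\<close>

definition frame_base :: "(nat \<times> (nat \<times> bit) list list) list" where
  "frame_base =
   [(0, [[(3,1),(4,1),(7,1)], [(4,0),(6,0),(12,0)], [(6,1),(8,1),(14,0)], [(1,0),(12,1),(13,0)],
         [(2,1),(9,0),(11,1)], [(7,0),(8,0),(11,0)], [(2,0),(13,1),(14,1)], [(1,1),(3,0),(9,1)]]),
    (5, [[(1,0),(7,0),(14,0)], [(8,1),(9,1),(12,0)], [(4,1),(11,0),(13,1)], [(4,0),(6,1),(12,1)],
         [(2,0),(3,0),(6,0)], [(2,1),(13,0),(14,1)], [(1,1),(3,1),(9,0)], [(7,1),(8,0),(11,1)]]),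
    (10, [[(3,0),(4,0),(7,1)], [(2,0),(3,1),(6,1)], [(6,0),(8,0),(14,0)], [(1,0),(12,0),(13,1)],
         [(8,1),(9,0),(12,1)], [(4,1),(11,1),(13,0)], [(1,1),(7,0),(14,1)], [(2,1),(9,1),(11,0)]])]"

definition decode :: "(nat \<times> (nat \<times> bit) list list) list \<Rightarrow> (f16 \<times> (f16 \<times> bit) list) list" where
  "decode = concat \<circ> map (\<lambda>(c, ts). map (\<lambda>t. (theta_pow c, map (\<lambda>(e, j). (theta_pow e, j)) t)) ts)"

text \<open>Multiplication by \<open>\<theta>\<^sup>3\<close>, of order 5; the orbits of the three
  base labels make up all 15 nonzero elements.\<close>

definition rot :: "f16 \<Rightarrow> f16" where "rot u = theta (theta (theta u))"

definition rotate_entry :: "f16 \<times> (f16 \<times> bit) list \<Rightarrow> f16 \<times> (f16 \<times> bit) list" where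
  "rotate_entry = (\<lambda>(c, t). (rot c, map (\<lambda>(u, j). (rot u, j)) t))"

fun orbit_table :: "nat \<Rightarrow> (f16 \<times> (f16 \<times> bit) list) list \<Rightarrow> (f16 \<times> (f16 \<times> bit) list) list" where
  "orbit_table 0 b = []"
| "orbit_table (Suc n) b = b @ map rotate_entry (orbit_table n b)"

text \<open>Finds the entries through \<open>p\<close> without expanding the table: those in a
  rotated copy come from entries through the point rotated back, and four rotations undo
  one.\<close>

fun frame_lookup :: "nat \<Rightarrow> (f16 \<times> (f16 \<times> bit) list) list \<Rightarrow> f16 \<times> bit \<Rightarrow> (f16 \<times> (f16 \<times> bit) list) list" where
  "frame_lookup 0 b p = []"
| "frame_lookup (Suc n) b p = filter (\<lambda>(c, t). p \<in> set t) b
     @ map rotate_entry (frame_lookup n b (rot (rot (rot (rot (fst p)))), snd p))"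

definition frame_table :: "(f16 \<times> (f16 \<times> bit) list) list" where
  "frame_table = orbit_table 5 (decode frame_base)"

text \<open>The multiples of \<open>{1, \<theta>, \<theta>\<^sup>4}\<close> by powers of \<open>\<theta>\<^sup>3\<close>: the triples \<open>{y, z, y + z}\<close> on which the third
  \<open>\<int>\<^sub>2\<close>-coordinate is the sum of the other two plus \<open>1\<close>. With all signs equal to \<open>0\<close> there is no frame
  invariant under multiplication by \<open>\<theta>\<^sup>3\<close>.\<close>

definition odd_planes :: "f16 list list" where
  "odd_planes = map (map theta_pow) [[0,1,4], [3,4,7], [6,7,10], [9,10,13], [12,13,1]]"

definition plane_sign :: "f16 list list \<Rightarrow> f16 \<Rightarrow> f16 \<Rightarrow> bit" where
  "plane_sign ps y z = (if list_ex (\<lambda>t. y \<in> set t \<and> z \<in> set t) ps then 1 else 0)"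

definition f16_list :: "f16 list" where
  "f16_list = concat (map (\<lambda>a. map (Pair a) f4_list) f4_list)"

text \<open>The zero vector comes first in \<open>f16_list\<close>, so \<open>tl\<close> removes
  it.\<close>

definition f16_points :: "(f16 \<times> bit) list" where
  "f16_points = concat (map (\<lambda>u. [(u, 0), (u, 1)]) (tl f16_list))"

text \<open>The sign rule is tested from all three pairs, so any two points determine the third. The
  last three conjuncts keep the triple off the span of its label \<open>c\<close>, the hole of the
  class.\<close>

fun check_triple :: "f16 list list \<Rightarrow> f16 \<times> (f16 \<times> bit) list \<Rightarrow> bool" where
  "check_triple ps (c, [p, q, r]) \<longleftrightarrow>
     r = p + q + (0, plane_sign ps (fst p) (fst q)) \<and> q = p + r + (0, plane_sign ps (fst p) (fst r)) \<and>
     p = q + r + (0, plane_sign ps (fst q) (fst r)) \<and> indep om2 (fst p) (fst q) \<and>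
     indep om2 c (fst p) \<and> indep om2 c (fst q) \<and> indep om2 c (fst r)"
| "check_triple ps _ \<longleftrightarrow> False"

text \<open>With \<open>tab\<close> the entries through \<open>p\<close>, these are the frame axioms
  at \<open>p\<close>: each class whose hole avoids \<open>p\<close> covers it once, and
  \<open>p\<close> is in one triple with each point of another group.\<close>

definition check_point :: "(f16 \<times> (f16 \<times> bit) list) list \<Rightarrow> f16 \<times> bit \<Rightarrow> bool" where
  "check_point tab p \<longleftrightarrow>
     list_all (\<lambda>c. indep om2 c (fst p) \<longrightarrow> length (filter (\<lambda>(c', t). c = c') tab) = 1) f16_list \<and>
     list_all (\<lambda>q. indep om2 (fst p) (fst q) \<longrightarrow> length (filter (\<lambda>(c, t). q \<in> set t) tab) = 1) f16_points"

definition check_orbit_point :: "(f16 \<times> (f16 \<times> bit) list) list \<Rightarrow> f16 \<times> bit \<Rightarrow> bool" where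
  "check_orbit_point b p \<longleftrightarrow> check_point (frame_lookup 5 b p) p"

lemma check_points_base: "list_all (check_orbit_point (decode frame_base)) f16_points"
  by code_simp

definition check_orbit_triple :: "f16 \<times> (f16 \<times> bit) list \<Rightarrow> bool" where
  "check_orbit_triple e \<longleftrightarrow> list_all (check_triple odd_planes)
     [e, rotate_entry e, rotate_entry (rotate_entry e), rotate_entry (rotate_entry (rotate_entry e)),
      rotate_entry (rotate_entry (rotate_entry (rotate_entry e)))]"

lemma check_triples_base: "list_all check_orbit_triple (decode frame_base)"
  by code_simp

lemma check_triples_frame_table: "list_all (check_triple odd_planes) frame_table"
  using check_triples_base
  by (auto simp: frame_table_def numeral_eq_Suc list_all_iff check_orbit_triple_def)

section \<open>The table as a Kirkman frame\<close>

interpretation f16: f4_space om2 "UNIV :: f16 set"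
proof
  show "x + x = 0" for x :: f16 by (simp add: prod_eq_iff)
  show "om2 (x + y) = om2 x + om2 y" for x y :: f16
    by (cases x; cases y) (simp only: add_Pair om2.simps om_add[symmetric])
  show "om2 (om2 x) = om2 x + x" for x :: f16
    by (cases x) (simp only: add_Pair om2.simps om_om)
qed simp_all

lemma set_f16_list: "set f16_list = UNIV"
  by (auto simp: f16_list_def)

definition rot_period :: "f16 \<Rightarrow> bool" where
  "rot_period u \<longleftrightarrow> rot (rot (rot (rot (rot u)))) = u"

text \<open>Five rotations multiply by the fifteenth power of \<open>\<theta>\<close>, which is
  1.\<close>

lemma rot_eq_iff: "rot u = v \<longleftrightarrow> u = rot (rot (rot (rot v)))"
proof -
  have "list_all rot_period f16_list" by code_simp
  then have "rot (rot (rot (rot (rot u)))) = u" for u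
    unfolding list_all_iff set_f16_list rot_period_def by blast
  then show ?thesis by metis
qed

lemma frame_lookup_eq: "frame_lookup n b p = filter (\<lambda>(c, t). p \<in> set t) (orbit_table n b)"
proof (induction n arbitrary: p)
  case (Suc n)
  have "p \<in> set (map (\<lambda>(u, j). (rot u, j)) t) \<longleftrightarrow>
      (rot (rot (rot (rot (fst p)))), snd p) \<in> set t" for t
  proof
    assume "p \<in> set (map (\<lambda>(u, j). (rot u, j)) t)"
    then obtain u j where u: "(u, j) \<in> set t" "p = (rot u, j)" by auto
    then have "rot u = fst p" by simp
    then have "u = rot (rot (rot (rot (fst p))))" by (rule rot_eq_iff[THEN iffD1])
    moreover have "(u, snd p) \<in> set t" using u by simp
    ultimately show "(rot (rot (rot (rot (fst p)))), snd p) \<in> set t" by (simp only:)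
  next
    assume *: "(rot (rot (rot (rot (fst p)))), snd p) \<in> set t"
    have "rot (rot (rot (rot (rot (fst p))))) = fst p" by (rule rot_eq_iff[THEN iffD2]) (rule refl)
    then have "(\<lambda>(u, j). (rot u, j)) (rot (rot (rot (rot (fst p)))), snd p) = p" by simp
    with * show "p \<in> set (map (\<lambda>(u, j). (rot u, j)) t)" by (metis image_eqI list.set_map)
  qed
  then have "(\<lambda>(c, t). p \<in> set t) (rotate_entry e) \<longleftrightarrow>
      (\<lambda>(c, t). (rot (rot (rot (rot (fst p)))), snd p) \<in> set t) e" for e
    by (cases e) (simp add: rotate_entry_def)
  then show ?case
    by (simp add: Suc filter_map o_def)
qed simp

lemma set_f16_points: "p \<in> set f16_points \<longleftrightarrow> fst p \<noteq> 0"
proof -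
  have "f16_list = 0 # tl f16_list" "distinct f16_list" by code_simp+
  then have "set (tl f16_list) = UNIV - {0}"
    by (metis Diff_insert_absorb distinct.simps(2) list.set(2) set_f16_list)
  then show ?thesis
    by (cases p; cases "snd p") (auto simp: f16_points_def)
qed

definition frame16 :: "f16 \<Rightarrow> (f16 \<times> bit) set set" where
  "frame16 c = {set t | t. (c, t) \<in> set frame_table}"

abbreviation "eps \<equiv> plane_sign odd_planes"

lemma plane_sign_sym: "plane_sign ps y z = plane_sign ps z y"
  by (simp add: plane_sign_def conj_commute)

lemma check_triple_shape: "check_triple ps e \<Longrightarrow> \<exists>c p q r. e = (c, [p, q, r])"
proof (induction ps e rule: check_triple.induct)
  case (1 ps c p q r)
  show ?case by blast
qed simp_all

text \<open>Only one pair is tested for independence; the other two follow because the third vector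
  is the sum of the first two.\<close>

lemma frame16_cases:
  assumes "T \<in> frame16 c"
  obtains p q r where "T = {p, q, r}"
    and "r = p + q + (0, eps (fst p) (fst q))" "q = p + r + (0, eps (fst p) (fst r))"
      "p = q + r + (0, eps (fst q) (fst r))"
    and "indep om2 (fst p) (fst q)" "indep om2 (fst p) (fst r)" "indep om2 (fst q) (fst r)"
    and "indep om2 c (fst p)" "indep om2 c (fst q)" "indep om2 c (fst r)"
proof -
  obtain t where t: "(c, t) \<in> set frame_table" "T = set t" using assms by (auto simp: frame16_def)
  then have ct: "check_triple odd_planes (c, t)" using check_triples_frame_table by (simp add: list_all_iff)
  obtain p q r where pqr: "t = [p, q, r]"
    using check_triple_shape[OF ct] prod.inject by metis
  from ct have c: "r = p + q + (0, eps (fst p) (fst q)) \<and> q = p + r + (0, eps (fst p) (fst r)) \<and>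
     p = q + r + (0, eps (fst q) (fst r)) \<and> indep om2 (fst p) (fst q) \<and>
     indep om2 c (fst p) \<and> indep om2 c (fst q) \<and> indep om2 c (fst r)"
    unfolding pqr check_triple.simps .
  then have "fst r = fst (p + q + (0, eps (fst p) (fst q)))" by (elim conjE) (rule arg_cong)
  then have r: "fst r = fst p + fst q" by simp
  have i: "indep om2 (fst p) (fst q)" using c by (elim conjE)
  have "indep om2 (fst p) (fst r)" "indep om2 (fst q) (fst r)"
    unfolding r using f16.indep_add[OF i] f16.indep_add[OF f16.indep_sym[OF i]]
    by (simp_all only: add.commute)
  moreover have "T = {p, q, r}" by (simp add: t(2) pqr)
  ultimately show ?thesis using c by (elim conjE) (rule that)
qed

lemma frame16_holey: "\<lbrakk>T \<in> frame16 c; p \<in> T\<rbrakk> \<Longrightarrow> indep om2 c (fst p)"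
  by (erule frame16_cases) blast

lemma frame16_third:
  assumes "T \<in> frame16 c" "p \<in> T" "q \<in> T" "p \<noteq> q"
  shows "indep om2 (fst p) (fst q) \<and> T = {p, q, p + q + (0, eps (fst p) (fst q))}"
proof -
  \<comment> \<open>\<open>P\<close> is symmetric, so the six ordered pairs reduce to the three
    given by \<open>frame16_cases\<close>.\<close>
  define P where "P p q \<longleftrightarrow> indep om2 (fst p) (fst q) \<and> T = {p, q, p + q + (0, eps (fst p) (fst q))}"
    for p q :: "f16 \<times> bit"
  have sym: "P q p" if "P p q" for p q
    unfolding P_def
  proof
    show "indep om2 (fst q) (fst p)" using that f16.indep_sym unfolding P_def by blast
    have "q + p + (0, eps (fst q) (fst p)) = p + q + (0, eps (fst p) (fst q))"
      by (simp only: add.commute[of q p] plane_sign_sym[of _ "fst q" "fst p"])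
    then show "T = {q, p, q + p + (0, eps (fst q) (fst p))}"
      using that unfolding P_def by (simp only: insert_commute)
  qed
  obtain x y z where T: "T = {x, y, z}" and xyz: "z = x + y + (0, eps (fst x) (fst y))"
    "y = x + z + (0, eps (fst x) (fst z))" "x = y + z + (0, eps (fst y) (fst z))"
    and i: "indep om2 (fst x) (fst y)" "indep om2 (fst x) (fst z)" "indep om2 (fst y) (fst z)"
    by (rule frame16_cases[OF assms(1)])
  have "P x y" unfolding P_def using i T by (simp only: xyz(1)[symmetric])
  moreover have "P x z" unfolding P_def using i T by (simp only: xyz(2)[symmetric] insert_commute)
  moreover have "P y z" unfolding P_def using i T by (simp only: xyz(3)[symmetric] insert_commute)
  moreover have "p = x \<and> q = y \<or> p = x \<and> q = z \<or> p = y \<and> q = z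
      \<or> q = x \<and> p = y \<or> q = x \<and> p = z \<or> q = y \<and> p = z"
    using assms(2-4) unfolding T by blast
  ultimately have "P p q" using sym by metis
  then show ?thesis unfolding P_def .
qed

lemma frame16_card: "T \<in> frame16 c \<Longrightarrow> card T = 3"
proof (elim frame16_cases)
  fix p q r assume "T = {p, q, r}"
    and "indep om2 (fst p) (fst q)" "indep om2 (fst p) (fst r)" "indep om2 (fst q) (fst r)"
  moreover from this have "p \<noteq> q" "p \<noteq> r" "q \<noteq> r"
    using f16.indep_neq by blast+
  ultimately show "card T = 3" by simp
qed

lemma check_point_frame:
  "fst p \<noteq> 0 \<Longrightarrow> check_point (filter (\<lambda>(c, t). p \<in> set t) frame_table) p"
  using check_points_base set_f16_points
  by (simp add: check_orbit_point_def list_all_iff frame_lookup_eq frame_table_def)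

lemma frame16_ex1:
  assumes "indep om2 c (fst p)" shows "\<exists>!T. T \<in> frame16 c \<and> p \<in> T"
proof -
  have "fst p \<noteq> 0" using f16.indep_sym[OF assms] by (simp add: indep_def)
  from check_point_frame[OF this] assms
  have "length (filter (\<lambda>(c', t). c = c') (filter (\<lambda>(c, t). p \<in> set t) frame_table)) = 1"
    by (simp only: check_point_def list_all_iff set_f16_list) blast
  then obtain e where e: "e \<in> set (filter (\<lambda>(c, t). p \<in> set t) frame_table)" "(\<lambda>(c', t). c = c') e"
    and u: "\<And>y. \<lbrakk>y \<in> set (filter (\<lambda>(c, t). p \<in> set t) frame_table); (\<lambda>(c', t). c = c') y\<rbrakk> \<Longrightarrow> y = e"
    by (rule length_filter_1E) blast
  obtain t where et: "e = (c, t)" using e(2) by (cases e) simp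
  from e(1) have t: "(c, t) \<in> set frame_table" "p \<in> set t"
    by (simp_all only: et set_filter mem_Collect_eq prod.case)
  show ?thesis
  proof (rule ex1I[of _ "set t"])
    show "set t \<in> frame16 c \<and> p \<in> set t" using t by (auto simp: frame16_def)
    fix S assume "S \<in> frame16 c \<and> p \<in> S"
    then obtain s where "S = set s" "(c, s) \<in> set frame_table" "p \<in> set s" by (auto simp: frame16_def)
    with u[of "(c, s)"] et show "S = set t" by simp
  qed
qed

lemma frame16_pair:
  assumes "indep om2 (fst p) (fst q)"
  obtains c T where "T \<in> frame16 c" "p \<in> T" "q \<in> T"
    and "\<And>d S. \<lbrakk>S \<in> frame16 d; p \<in> S; q \<in> S\<rbrakk> \<Longrightarrow> d = c \<and> S = T"
proof -
  have "fst p \<noteq> 0" "fst q \<noteq> 0"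
    using assms f16.indep_sym[OF assms] by (simp_all add: indep_def)
  from check_point_frame[OF this(1)] this(2) assms
  have "length (filter (\<lambda>(c, t). q \<in> set t) (filter (\<lambda>(c, t). p \<in> set t) frame_table)) = 1"
    using set_f16_points[of q] by (simp only: check_point_def list_all_iff) blast
  then obtain e where e: "e \<in> set (filter (\<lambda>(c, t). p \<in> set t) frame_table)" "(\<lambda>(c, t). q \<in> set t) e"
    and u: "\<And>y. \<lbrakk>y \<in> set (filter (\<lambda>(c, t). p \<in> set t) frame_table); (\<lambda>(c, t). q \<in> set t) y\<rbrakk> \<Longrightarrow> y = e"
    by (rule length_filter_1E) blast
  obtain c t where et: "e = (c, t)" by (cases e)
  from e have t: "(c, t) \<in> set frame_table" "p \<in> set t" "q \<in> set t"
    by (simp_all only: et set_filter mem_Collect_eq prod.case)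
  show ?thesis
  proof (rule that[of "set t" c])
    show "set t \<in> frame16 c" "p \<in> set t" "q \<in> set t" using t by (auto simp: frame16_def)
    fix d S assume "S \<in> frame16 d" "p \<in> S" "q \<in> S"
    then obtain s where "S = set s" "(d, s) \<in> set frame_table" "p \<in> set s" "q \<in> set s"
      by (auto simp: frame16_def)
    with u[of "(d, s)"] et show "d = c \<and> S = set t" by simp
  qed
qed

lemma bit_solve:
  fixes a b e s :: bit
  assumes "a = b + (b + a + e) + s" shows "s = e"
proof -
  have "b + (b + a + e) = a + e" by (simp only: add.assoc[symmetric] bit_add_self add_0)
  then have "a + e + s = b + (b + a + e) + s" by (simp only:)
  also have "\<dots> = a" by (rule assms[symmetric])
  finally have "a + e + s = a" .
  then have "a + (e + s) = a + 0" by (simp only: add.assoc add_0_right)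
  then have "e + s = e + e" by (simp only: add_left_cancel bit_add_self)
  then show ?thesis by (simp only: add_left_cancel)
qed

text \<open>Ensures that the quadruples \<open>{a} \<union> (a + S)\<close> with \<open>S\<close> in the frame look alike from each of their points.\<close>

lemma frame16_shift:
  assumes T: "T \<in> frame16 c" and p: "p \<in> T"
  shows "\<exists>d. insert p ((+) p ` (T - {p})) \<in> frame16 d"
proof -
  have "card (T - {p}) = 2" using frame16_card[OF T] p by (simp add: card_Diff_singleton)
  then obtain q where q: "q \<in> T" "q \<noteq> p" by (metis Diff_iff card.empty ex_in_conv insertI1 zero_neq_numeral)
  define e where "e = eps (fst p) (fst q)"
  let ?r = "p + q + (0, e)"
  have i: "indep om2 (fst p) (fst q)" and Teq: "T = {p, q, ?r}"
    using frame16_third[OF T p q(1)] q(2) by (auto simp: e_def)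
  have add_self: "x + (x + y) = y" for x y :: "f16 \<times> bit"
    by (simp add: prod_eq_iff flip: add.assoc)
  have ir: "indep om2 (fst p) (fst ?r)" using f16.indep_add[OF i] by simp
  then have "p \<noteq> ?r" using f16.span1_self[of "fst p"] by (auto simp only: indep_def)
  moreover have "?r \<in> T" by (subst Teq) simp
  ultimately have "T = {p, ?r, p + ?r + (0, eps (fst p) (fst ?r))}"
    using frame16_third[OF T p, THEN conjunct2] by blast
  moreover have "q \<noteq> ?r"
  proof
    assume "q = ?r"
    then have "fst q = fst ?r" by (rule arg_cong)
    then have "fst p = 0" by simp
    with i show False by (simp add: indep_def)
  qed
  \<comment> \<open>Completing the pair \<open>p\<close>, \<open>?r\<close> gives back
    \<open>q\<close>, so this pair has the same sign \<open>e\<close> as \<open>p\<close>,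
    \<open>q\<close>.\<close>
  ultimately have "q = p + ?r + (0, eps (fst p) (fst ?r))"
    using q Teq by blast
  then have "snd q = snd (p + ?r + (0, eps (fst p) (fst ?r)))" by (rule arg_cong)
  then have "snd q = snd p + (snd p + snd q + e) + eps (fst p) (fst ?r)" by (simp only: snd_add snd_conv)
  then have e'': "eps (fst p) (fst ?r) = e"
    by (rule bit_solve)
  have "fst ?r = fst p + fst q" by simp
  with e'' have e': "eps (fst p) (fst p + fst q) = e" by (simp only:)
  have i2: "indep om2 (fst p) (fst (p + q))" using f16.indep_add[OF i] by simp
  \<comment> \<open>The pair \<open>p\<close>, \<open>p + q\<close> has sign \<open>e\<close> too,
    so the third point of its triple is \<open>p + ?r\<close>, and \<open>S\<close> is the shifted
    triple.\<close>
  obtain d S where S: "S \<in> frame16 d" "p \<in> S" "p + q \<in> S"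
    using frame16_pair[OF i2] by metis
  have "p \<noteq> p + q"
  proof
    assume "p = p + q"
    then have "fst p = fst (p + q)" by (rule arg_cong)
    then have "fst q = 0" by simp
    with f16.indep_sym[OF i] show False by (simp add: indep_def)
  qed
  then have "S = {p, p + q, p + (p + q) + (0, eps (fst p) (fst (p + q)))}"
    using frame16_third[OF S] by blast
  also have "\<dots> = {p, p + q, p + ?r}" by (simp add: e' add_self add.assoc)
  also have "\<dots> = insert p ((+) p ` {q, ?r})" by simp
  also have "{q, ?r} = T - {p}" using q(2) \<open>p \<noteq> ?r\<close> Teq by blast
  finally show ?thesis using S by blast
qed

section \<open>The quadruple system on ten points\<close>

definition stem_quad_list :: "f4 \<Rightarrow> f4 stem_pt list" where
  "stem_quad_list a = [Inl (a, 0), Inl (a, 1), Inr 0, Inr 1]"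

text \<open>The block misses the fibre over \<open>a\<close>: the other three field elements are the
  translates of \<open>a\<close> by 1, \<omega> and 1 + \<omega>.\<close>

definition cross_block :: "bit \<Rightarrow> f4 \<Rightarrow> bit \<Rightarrow> f4 stem_pt list" where
  "cross_block k a j = [Inr k, Inl (a + (1, 0), j + k + snd a), Inl (a + (0, 1), j),
     Inl (a + (1, 1), j + fst a + 1)]"

text \<open>The 30 blocks by type: both stems and a fibre (4), two fibres (2), a fibre and one point
  over each of two others (8), a stem and three points over different elements (16).\<close>

definition sqs10 :: "f4 stem_pt list list" where
  "sqs10 = map stem_quad_list f4_list
     @ map (\<lambda>a. [Inl (a, 0), Inl (a, 1), Inl (a + (1, 0), 0), Inl (a + (1, 0), 1)]) [(0, 0), (0, 1)]
     @ concat (map (\<lambda>a. map (\<lambda>j. [Inl (a, 0), Inl (a, 1), Inl (a + (0, 1), j),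
         Inl (a + (1, 1), j + fst a + 1)]) [0, 1]) f4_list)
     @ concat (map (\<lambda>a. [cross_block 0 a 0, cross_block 0 a 1, cross_block 1 a 0, cross_block 1 a 1]) f4_list)"

definition sqs10_points :: "f4 stem_pt list" where
  "sqs10_points = [Inr 0, Inr 1] @ map (\<lambda>a. Inl (a, 0)) f4_list @ map (\<lambda>a. Inl (a, 1)) f4_list"

text \<open>The derived designs are affine planes of order three, so a parallel class is given by one of its
  blocks. At a point over \<open>a\<close>, class \<open>c \<noteq> a\<close> is the one that contains a block through the stem \<open>Inr 0\<close>
  avoiding the fibres over \<open>c\<close>.\<close>

definition class_rep :: "f4 stem_pt \<Rightarrow> f4 \<Rightarrow> f4 stem_pt list" where
  "class_rep p c = (case p of Inr k \<Rightarrow> stem_quad_list c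
     | Inl (a, i) \<Rightarrow> if a = c then stem_quad_list a
         else if p \<in> set (cross_block 0 c 0) then cross_block 0 c 0 else cross_block 0 c 1)"

definition common :: "'a list \<Rightarrow> 'a list \<Rightarrow> 'a list" where
  "common b d = filter (\<lambda>x. x \<in> set d) b"

text \<open>Two blocks through \<open>p\<close> have two common points unless they are equal or meet only in \<open>p\<close>.\<close>

definition classes10 :: "f4 stem_pt \<Rightarrow> f4 \<Rightarrow> f4 stem_pt list list" where
  "classes10 p c = filter (\<lambda>b. p \<in> set b \<and> length (common b (class_rep p c)) \<noteq> 2) sqs10"

definition partition_check :: "f4 stem_pt \<Rightarrow> f4 stem_pt list list \<Rightarrow> bool" where
  "partition_check p bs \<longleftrightarrow>
     list_all (\<lambda>q. q = p \<or> length (filter (\<lambda>b. q \<in> set b) bs) = 1) sqs10_points"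

definition colour_check :: "f4 stem_pt \<Rightarrow> f4 stem_pt list list list \<Rightarrow> bool" where
  "colour_check p cs \<longleftrightarrow> list_all (\<lambda>b. p \<in> set b \<longrightarrow>
     length (filter (\<lambda>bs. b \<in> set bs) cs) = 1) sqs10"

lemma sqs10_blocks: "list_all (\<lambda>b. distinct b \<and> length b = 4) sqs10"
  by code_simp

lemma sqs10_cover:
  "list_all (\<lambda>p. list_all (\<lambda>q. p = q \<or> list_all (\<lambda>r. p = r \<or> q = r \<or>
     list_ex (\<lambda>b. r \<in> set b) (filter (\<lambda>b. p \<in> set b \<and> q \<in> set b) sqs10))
       sqs10_points) sqs10_points) sqs10_points"
  by code_simp

lemma sqs10_meet:
  "list_all (\<lambda>b. list_all (\<lambda>d. b = d \<or> length (common b d) \<le> 2) sqs10) sqs10"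
  by code_simp

lemma mem_sqs10_points: "p \<in> set sqs10_points"
proof (cases p)
  case (Inl v)
  then show ?thesis by (cases v; cases "snd v") (auto simp: sqs10_points_def)
next
  case (Inr k)
  then show ?thesis by (cases k) (auto simp: sqs10_points_def)
qed

definition special_check :: "f4 \<Rightarrow> bool" where
  "special_check a \<longleftrightarrow> list_all (\<lambda>cs. stem_quad_list a \<in> set cs) (map (\<lambda>p. classes10 p a) (stem_quad_list a))"

definition point_check :: "f4 stem_pt \<Rightarrow> bool" where
  "point_check p \<longleftrightarrow> list_all (partition_check p) (map (classes10 p) f4_list) \<and>
     colour_check p (map (classes10 p) f4_list)"

lemma sqs10_points_check: "list_all point_check sqs10_points"
  by code_simp

lemma special_blocks_check: "list_all special_check f4_list"
  by code_simp

lemma classes10_partition: "partition_check p (classes10 p c)"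
  and classes10_colour: "colour_check p (map (classes10 p) f4_list)"
  using sqs10_points_check mem_sqs10_points[of p]
  unfolding list_all_iff point_check_def set_map set_f4_list by blast+

lemma classes10_special: "p \<in> stem_quad a \<Longrightarrow> stem_quad_list a \<in> set (classes10 p a)"
  using special_blocks_check by (cases a) (auto simp: list_all_iff special_check_def stem_quad_def stem_quad_list_def)


section \<open>From lists to sets of blocks\<close>

definition B10 :: "f4 stem_pt set set" where "B10 = set ` set sqs10"

definition K10 :: "f4 stem_pt \<Rightarrow> f4 \<Rightarrow> f4 stem_pt set set" where
  "K10 p c = set ` set (classes10 p c)"

text \<open>By \<open>sqs10_meet\<close> different blocks share at most two points; existence comes
  from \<open>sqs10_cover\<close>.\<close>

lemma sqs10_eqI:
  assumes b: "b \<in> set sqs10" and d: "d \<in> set sqs10"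
    and "distinct [p, q, r]" "{p, q, r} \<subseteq> set b \<inter> set d"
  shows "b = d"
proof (rule ccontr)
  assume "b \<noteq> d"
  with b d sqs10_meet have "length (common b d) \<le> 2" unfolding list_all_iff by blast
  moreover have "{p, q, r} \<subseteq> set (common b d)" using assms(4) by (auto simp: common_def)
  then have "card {p, q, r} \<le> card (set (common b d))" by (rule card_mono[rotated]) simp
  then have "3 \<le> length (common b d)" using assms(3) card_length[of "common b d"] by simp
  ultimately show False by simp
qed

text \<open>Lets counts over lists carry over to blocks as sets; equal sets share three points, so
  \<open>sqs10_eqI\<close> applies.\<close>

lemma inj_set_sqs10: "inj_on set (set sqs10)"
proof (rule inj_onI)
  fix b d assume bd: "b \<in> set sqs10" "d \<in> set sqs10" "set b = set d"
  then have "distinct b" "length b = 4" using sqs10_blocks unfolding list_all_iff by blast+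
  then have "card (set b) = 4" by (simp add: distinct_card)
  then obtain T where "T \<subseteq> set b" "card T = 3" using obtain_subset_with_card_n[of 3 "set b"] by auto
  then obtain p q r where "{p, q, r} \<subseteq> set b" "distinct [p, q, r]" unfolding card_3_iff by auto
  with sqs10_eqI[OF bd(1,2)] bd(3) show "b = d" by blast
qed

lemma classes10_sub: "b \<in> set (classes10 p c) \<Longrightarrow> b \<in> set sqs10 \<and> p \<in> set b"
  by (simp add: classes10_def)

lemma mem_K10: "b \<in> set sqs10 \<Longrightarrow> set b \<in> K10 p c \<longleftrightarrow> b \<in> set (classes10 p c)"
  unfolding K10_def using inj_set_sqs10 classes10_sub by (metis (no_types, lifting) image_iff inj_onD)

lemma stemmed10: "stemmed UNIV B10 K10"
  unfolding stemmed_def coloured_SQS_def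
proof (intro conjI ballI impI)
  fix b assume "b \<in> B10"
  then obtain l where l: "l \<in> set sqs10" "b = set l" by (auto simp: B10_def)
  then have "distinct l" "length l = 4" using sqs10_blocks unfolding list_all_iff by blast+
  with l show "card b = 4" by (simp add: distinct_card)
  show "b \<subseteq> stem_points UNIV"
  proof
    show "p \<in> stem_points UNIV" for p :: "f4 stem_pt" by (cases p) simp_all
  qed
next
  fix p q r :: "f4 stem_pt" assume d: "distinct [p, q, r]"
  note cover = sqs10_cover[unfolded list_all_iff list_ex_iff, THEN bspec[OF _ mem_sqs10_points[of p]],
      THEN bspec[OF _ mem_sqs10_points[of q]]]
  have "\<forall>r\<in>set sqs10_points. p = r \<or> q = r \<or>
      (\<exists>b\<in>set (filter (\<lambda>b. p \<in> set b \<and> q \<in> set b) sqs10). r \<in> set b)"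
    using cover d by simp
  from bspec[OF this mem_sqs10_points[of r]] d
  have "\<exists>b\<in>set sqs10. p \<in> set b \<and> q \<in> set b \<and> r \<in> set b" by auto
  then obtain b where b: "b \<in> set sqs10" "p \<in> set b" "q \<in> set b" "r \<in> set b" by blast
  show "\<exists>!b. b \<in> B10 \<and> p \<in> b \<and> q \<in> b \<and> r \<in> b"
  proof (rule ex1I[of _ "set b"])
    show "set b \<in> B10 \<and> p \<in> set b \<and> q \<in> set b \<and> r \<in> set b" using b by (simp add: B10_def)
    fix e assume "e \<in> B10 \<and> p \<in> e \<and> q \<in> e \<and> r \<in> e"
    then obtain l where "l \<in> set sqs10" "e = set l" "p \<in> set l" "q \<in> set l" "r \<in> set l"
      by (auto simp: B10_def)
    with sqs10_eqI[OF b(1) _ d] b show "e = set b" by blast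
  qed
next
  fix p :: "f4 stem_pt" and c :: f4
  show "K10 p c \<subseteq> {b \<in> B10. p \<in> b}"
    using classes10_sub[of _ p c] unfolding K10_def B10_def by blast
next
  fix p :: "f4 stem_pt" and b assume "b \<in> B10" "p \<in> b"
  then obtain l where l: "l \<in> set sqs10" "b = set l" "p \<in> set l" by (auto simp: B10_def)
  have "colour_check p (map (classes10 p) f4_list)"
    by (rule classes10_colour)
  then have "length (filter (\<lambda>bs. l \<in> set bs) (map (classes10 p) f4_list)) = 1"
    using l(1,3) unfolding colour_check_def list_all_iff by blast
  then have "length (filter (\<lambda>c. l \<in> set (classes10 p c)) f4_list) = 1"
    by (simp add: filter_map o_def)
  then obtain c where c: "l \<in> set (classes10 p c)"
    and u: "\<And>d. \<lbrakk>d \<in> set f4_list; l \<in> set (classes10 p d)\<rbrakk> \<Longrightarrow> d = c"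
    by (rule length_filter_1E) blast
  show "\<exists>!c. c \<in> UNIV \<and> b \<in> K10 p c"
    unfolding l(2) mem_K10[OF l(1)]
  proof (rule ex1I[of _ c])
    show "c \<in> UNIV \<and> l \<in> set (classes10 p c)" using c by simp
    show "d \<in> UNIV \<and> l \<in> set (classes10 p d) \<Longrightarrow> d = c" for d
      using u[of d] unfolding set_f4_list by blast
  qed
next
  fix p q :: "f4 stem_pt" and c :: f4 assume "p \<noteq> q"
  have "partition_check p (classes10 p c)"
    by (rule classes10_partition)
  from bspec[OF this[unfolded partition_check_def list_all_iff] mem_sqs10_points[of q]] \<open>p \<noteq> q\<close>
  have "length (filter (\<lambda>b. q \<in> set b) (classes10 p c)) = 1" by (simp only: eq_commute[of q p] simp_thms)
  then obtain b where b: "b \<in> set (classes10 p c)" "q \<in> set b"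
    "\<And>d. \<lbrakk>d \<in> set (classes10 p c); q \<in> set d\<rbrakk> \<Longrightarrow> d = b"
    by (rule length_filter_1E) blast
  show "\<exists>!b. b \<in> K10 p c \<and> q \<in> b"
  proof (rule ex1I[of _ "set b"])
    show "set b \<in> K10 p c \<and> q \<in> set b" using b(1,2) by (simp add: K10_def)
    fix e assume "e \<in> K10 p c \<and> q \<in> e"
    then obtain l where "e = set l" "l \<in> set (classes10 p c)" "q \<in> set l" unfolding K10_def by blast
    with b(3) show "e = set b" by blast
  qed
next
  fix a :: f4
  have sp: "stem_quad a = set (stem_quad_list a)" by (simp add: stem_quad_def stem_quad_list_def)
  have "stem_quad_list a \<in> set sqs10" by (simp add: sqs10_def)
  then show "stem_quad a \<in> B10" by (simp add: B10_def sp)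
  fix p assume "p \<in> stem_quad a"
  then have "stem_quad_list a \<in> set (classes10 p a)" by (rule classes10_special)
  then show "stem_quad a \<in> K10 p a" by (simp add: K10_def sp)
qed

section \<open>The frame and the quadruples of non-collinear points\<close>

text \<open>Identifies the scalar action with field multiplication, which makes plane coordinates
  linear over the field (\<open>coord_scal\<close>).\<close>

lemma scal_om: "scal om a u = f4_times a u"
proof -
  obtain x y where a: "a = (x, y)" by (cases a)
  obtain z t where u: "u = (z, t)" by (cases u)
  show ?thesis
    unfolding a u by (cases x; cases y; cases z; cases t) (simp_all add: scal_def f4_times_def zero_prod_def add_ac)
qed

lemma scal_om2: "scal om2 a u = (f4_times a (fst u), f4_times a (snd u))"
  by (cases u) (simp add: scal_om[symmetric] scal_def zero_prod_def)

context f4_space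
begin

section \<open>The frame in any dimension\<close>

definition planes :: "'v set set" where
  "planes = {plane e f | e f. e \<in> V \<and> f \<in> V \<and> indep w e f}"

text \<open>A coordinate isomorphism chosen once for each plane, so that a plane carries one copy of
  the table although it has many bases.\<close>

definition coord :: "'v set \<Rightarrow> f16 \<Rightarrow> 'v" where
  "coord P = (SOME g. \<exists>e f. e \<in> V \<and> f \<in> V \<and> indep w e f \<and> plane e f = P \<and> g = comb e f)"

lemma coord_comb:
  assumes "P \<in> planes"
  obtains e f where "e \<in> V" "f \<in> V" "indep w e f" "plane e f = P" "coord P = comb e f"
proof -
  have "\<exists>g. \<exists>e f. e \<in> V \<and> f \<in> V \<and> indep w e f \<and> plane e f = P \<and> g = comb e f"
    using assms unfolding planes_def by blast
  from someI_ex[OF this] that show ?thesis unfolding coord_def by blast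
qed

lemma plane_mem_planes: "\<lbrakk>y \<in> V; z \<in> V; indep w y z\<rbrakk> \<Longrightarrow> plane y z \<in> planes"
  unfolding planes_def by blast

lemma planes_sub: "P \<in> planes \<Longrightarrow> P \<subseteq> V"
  unfolding planes_def using plane_mem by blast

lemma planes_eq:
  assumes "P \<in> planes" "y \<in> P" "z \<in> P" "indep w y z" shows "P = plane y z"
  using assms plane_eq unfolding planes_def by blast

lemma
  assumes P: "P \<in> planes"
  shows range_coord: "range (coord P) = P"
    and inj_coord: "inj (coord P)"
    and coord_add: "coord P (u + v) = coord P u + coord P v"
    and coord_0: "coord P u = 0 \<longleftrightarrow> u = 0"
    and coord_scal: "coord P (scal om2 a u) = scal w a (coord P u)"
proof -
  obtain e f where *: "indep w e f" "plane e f = P" "coord P = comb e f"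
    using coord_comb[OF P] by blast
  show "range (coord P) = P" using * by (simp add: plane_def)
  show inj: "inj (coord P)" using * inj_comb by simp
  show "coord P (u + v) = coord P u + coord P v" for u v using * comb_add by simp
  have "comb e f 0 = 0" by (simp add: comb_def)
  then show "coord P u = 0 \<longleftrightarrow> u = 0" using comb_eq_0[OF *(1)] * by metis
  show "coord P (scal om2 a u) = scal w a (coord P u)"
    unfolding scal_om2 * by (rule comb_scal)
qed

lemma coord_span1:
  assumes P: "P \<in> planes"
  shows "coord P u \<in> span1 w (coord P v) \<longleftrightarrow> u \<in> span1 om2 v"
  unfolding span1_iff coord_scal[OF P, symmetric]
  using inj_coord[OF P] by (auto dest: injD)

lemma coord_indep: "P \<in> planes \<Longrightarrow> indep w (coord P u) (coord P v) \<longleftrightarrow> indep om2 u v"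
  by (simp add: indep_def coord_span1 coord_0)

definition lift :: "'v set \<Rightarrow> f16 \<times> bit \<Rightarrow> 'v \<times> bit" where
  "lift P p = (coord P (fst p), snd p)"

lemma fst_lift [simp]: "fst (lift P p) = coord P (fst p)" and snd_lift [simp]: "snd (lift P p) = snd p"
  by (simp_all add: lift_def)

lemma lift_add: "P \<in> planes \<Longrightarrow> lift P (p + q) = lift P p + lift P q"
  by (simp add: prod_eq_iff coord_add)

lemma inj_lift: "P \<in> planes \<Longrightarrow> inj (lift P)"
  using inj_coord by (auto simp: inj_def lift_def prod_eq_iff)

lemma lift_surj:
  assumes "P \<in> planes" "fst p \<in> P" obtains p' where "p = lift P p'"
proof -
  obtain u where "fst p = coord P u" using assms range_coord by blast
  then have "p = lift P (u, snd p)" by (simp add: prod_eq_iff)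
  then show ?thesis by (rule that)
qed

definition frame :: "'v \<Rightarrow> ('v \<times> bit) set set" where
  "frame c = {lift P ` T | P d T. P \<in> planes \<and> T \<in> frame16 d \<and> c = coord P d}"

lemma frameE:
  assumes "S \<in> frame c"
  obtains P d T where "P \<in> planes" "T \<in> frame16 d" "S = lift P ` T" "c = coord P d"
  using assms unfolding frame_def by blast

lemma frame_holey:
  assumes "S \<in> frame c" "p \<in> S"
  shows "indep w c (fst p)" and "c \<in> V" and "fst p \<in> V"
proof -
  obtain P d T where P: "P \<in> planes" "T \<in> frame16 d" "S = lift P ` T" "c = coord P d"
    using assms by (elim frameE)
  then obtain p' where p': "p' \<in> T" "p = lift P p'" using assms by blast
  show "indep w c (fst p)" using frame16_holey[OF P(2) p'(1)] P p' coord_indep by simp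
  show "c \<in> V" "fst p \<in> V" using range_coord[OF P(1)] planes_sub[OF P(1)] P p' by auto
qed

lemma frame_card: "S \<in> frame c \<Longrightarrow> card S = 3"
  using frame16_card inj_lift by (elim frameE) (simp add: card_image inj_on_subset[OF _ subset_UNIV])

lemma frame_third:
  assumes "S \<in> frame c" "p \<in> S" "q \<in> S" "p \<noteq> q"
  shows "indep w (fst p) (fst q) \<and> (\<exists>e. S = {p, q, p + q + (0, e)})"
proof -
  obtain P d T where P: "P \<in> planes" "T \<in> frame16 d" "S = lift P ` T" "c = coord P d"
    using assms by (elim frameE)
  then obtain p' q' where p': "p' \<in> T" "p = lift P p'" "q' \<in> T" "q = lift P q'" using assms by blast
  then have "p' \<noteq> q'" using assms by blast
  then obtain e where i: "indep om2 (fst p') (fst q')" and T: "T = {p', q', p' + q' + (0, e)}"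
    using frame16_third[OF P(2) p'(1,3)] by blast
  have "coord P 0 = 0" using coord_0[OF P(1)] by blast
  then have "lift P (p' + q' + (0, e)) = p + q + (0, e)"
    using P(1) p' by (simp add: lift_add) (simp add: prod_eq_iff)
  then have "S = {p, q, p + q + (0, e)}" unfolding P(3) p' T by simp
  moreover have "indep w (fst p) (fst q)" using i p' P(1) coord_indep by simp
  ultimately show ?thesis by blast
qed

text \<open>The label and the points of a triple lie in its plane, so two independent vectors among
  them recover it. This reduces uniqueness to dimension two.\<close>

lemma frame_plane:
  assumes S: "S = lift P ` T" and P: "P \<in> planes" "T \<in> frame16 d"
    and yz: "indep w y z" "y \<in> insert (coord P d) (fst ` S)" "z \<in> insert (coord P d) (fst ` S)"
  shows "P = plane y z"
proof -
  have "insert (coord P d) (fst ` S) \<subseteq> P" using range_coord[OF P(1)] S by auto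
  then show ?thesis using planes_eq[OF P(1)] yz by blast
qed

lemma frame_ex1:
  assumes c: "c \<in> V" and p: "fst p \<in> V" and i: "indep w c (fst p)"
  shows "\<exists>!S. S \<in> frame c \<and> p \<in> S"
proof -
  define P where "P = plane c (fst p)"
  have P: "P \<in> planes" using plane_mem_planes[OF c p i] by (simp add: P_def)
  have "c \<in> P" "fst p \<in> P" unfolding P_def by (rule plane_gen)+
  then obtain d p' where d: "c = coord P d" "p = lift P p'"
    using range_coord[OF P] lift_surj[OF P] by (metis imageE)
  then have "indep om2 d (fst p')" using i coord_indep[OF P] by simp
  then obtain T where T: "T \<in> frame16 d" "p' \<in> T" and u: "\<And>T'. \<lbrakk>T' \<in> frame16 d; p' \<in> T'\<rbrakk> \<Longrightarrow> T' = T"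
    using frame16_ex1 by metis
  show ?thesis
  proof (rule ex1I[of _ "lift P ` T"])
    show "lift P ` T \<in> frame c \<and> p \<in> lift P ` T"
      using P T d unfolding frame_def by blast
    fix S assume S: "S \<in> frame c \<and> p \<in> S"
    then obtain P' d' T' where P': "P' \<in> planes" "T' \<in> frame16 d'" "S = lift P' ` T'" "c = coord P' d'"
      by (elim conjE frameE)
    have "P' = P" unfolding P_def using frame_plane[OF P'(3,1,2) i] S P'(4) by blast
    with P' d inj_coord[OF P] have "d' = d" by (metis injD)
    moreover have "p' \<in> T'"
      using S P' \<open>P' = P\<close> d(2) inj_lift[OF P] by (metis inj_image_mem_iff)
    ultimately show "S = lift P ` T" using u P' \<open>P' = P\<close> by blast
  qed
qed

lemma frame_pair:
  assumes p: "fst p \<in> V" and q: "fst q \<in> V" and i: "indep w (fst p) (fst q)"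
  obtains c S where "S \<in> frame c" "p \<in> S" "q \<in> S"
    and "\<And>d S'. \<lbrakk>S' \<in> frame d; p \<in> S'; q \<in> S'\<rbrakk> \<Longrightarrow> d = c \<and> S' = S"
proof -
  define P where "P = plane (fst p) (fst q)"
  have P: "P \<in> planes" using plane_mem_planes[OF p q i] by (simp add: P_def)
  have "fst p \<in> P" "fst q \<in> P" unfolding P_def by (rule plane_gen)+
  then obtain p' q' where d: "p = lift P p'" "q = lift P q'"
    using lift_surj[OF P] by metis
  then have "indep om2 (fst p') (fst q')" using i coord_indep[OF P] by simp
  then obtain c T where T: "T \<in> frame16 c" "p' \<in> T" "q' \<in> T"
    and u: "\<And>d T'. \<lbrakk>T' \<in> frame16 d; p' \<in> T'; q' \<in> T'\<rbrakk> \<Longrightarrow> d = c \<and> T' = T"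
    by (rule frame16_pair) blast
  show ?thesis
  proof (rule that[of "lift P ` T" "coord P c"])
    show "lift P ` T \<in> frame (coord P c)" "p \<in> lift P ` T" "q \<in> lift P ` T"
      using P T d unfolding frame_def by blast+
    fix d S assume S: "S \<in> frame d" "p \<in> S" "q \<in> S"
    then obtain P' d' T' where P': "P' \<in> planes" "T' \<in> frame16 d'" "S = lift P' ` T'" "d = coord P' d'"
      by (elim frameE)
    have "P' = P" unfolding P_def using frame_plane[OF P'(3,1,2) i] S by blast
    moreover have "p' \<in> T'" "q' \<in> T'"
      using S P' \<open>P' = P\<close> d inj_lift[OF P] by (metis inj_image_mem_iff)+
    ultimately show "d = coord P c \<and> S = lift P ` T" using u P' by blast
  qed
qed

lemma frame_shift:
  assumes "S \<in> frame c" "p \<in> S"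
  shows "\<exists>d. insert p ((+) p ` (S - {p})) \<in> frame d"
proof -
  obtain P d T where P: "P \<in> planes" "T \<in> frame16 d" "S = lift P ` T" "c = coord P d"
    using assms by (elim frameE)
  then obtain p' where p': "p' \<in> T" "p = lift P p'" using assms by blast
  obtain e where e: "insert p' ((+) p' ` (T - {p'})) \<in> frame16 e"
    using frame16_shift[OF P(2) p'(1)] by blast
  have "S - {p} = lift P ` (T - {p'})"
    unfolding P(3) p'(2) using inj_lift[OF P(1)] by (auto dest: injD)
  then have "(+) p ` (S - {p}) = lift P ` (+) p' ` (T - {p'})"
    by (simp add: image_image lift_add[OF P(1)] p'(2))
  then have "insert p ((+) p ` (S - {p})) = lift P ` insert p' ((+) p' ` (T - {p'}))"
    by (simp add: p'(2))
  then show ?thesis using e P(1) unfolding frame_def by blast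
qed

section \<open>Quadruples as translated frame triples\<close>

lemma add_self_pt: "(p :: 'v \<times> bit) + p = 0"
  by (simp add: prod_eq_iff add_self)

lemma add_self_pt_left: "(p :: 'v \<times> bit) + (p + q) = q"
  by (simp add: add_self_pt flip: add.assoc)

lemma add_pt_eq_0: "(p :: 'v \<times> bit) + q = 0 \<longleftrightarrow> p = q"
  using add_self_pt add_self_pt_left by (metis add_0_right)

definition quads :: "('v \<times> bit) set set" where
  "quads = {(+) a ` insert 0 S | a S c. fst a \<in> V \<and> S \<in> frame c}"

lemma quadsI: "\<lbrakk>fst a \<in> V; S \<in> frame c\<rbrakk> \<Longrightarrow> (+) a ` insert 0 S \<in> quads"
  unfolding quads_def by blast

text \<open>The frame class is that of the difference of \<open>c\<close> and \<open>fst p\<close>;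
  for \<open>c = fst p\<close> it is the class of 0, which is empty.\<close>

definition quad_class :: "'v \<times> bit \<Rightarrow> 'v \<Rightarrow> ('v \<times> bit) set set" where
  "quad_class p c = {(+) p ` insert 0 S | S. S \<in> frame (fst p + c)}"

lemma mem_shift: "(q :: 'v \<times> bit) \<in> (+) p ` A \<longleftrightarrow> p + q \<in> A"
proof
  assume "p + q \<in> A"
  then have "p + (p + q) \<in> (+) p ` A" by (rule imageI)
  then show "q \<in> (+) p ` A" by (simp only: add_self_pt_left)
qed (auto simp: add_self_pt_left)

lemma zero_notin_frame: "S \<in> frame c \<Longrightarrow> 0 \<notin> S"
  using frame_holey(1)[of S c 0] span1_zero by (auto simp: indep_def)

lemma frame_pt_neq_0: "\<lbrakk>S \<in> frame c; p \<in> S\<rbrakk> \<Longrightarrow> p \<noteq> 0"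
  using zero_notin_frame by blast

text \<open>By \<open>frame_shift\<close> a quadruple looks alike from each of its points, so later
  arguments can translate \<open>p\<close> to 0.\<close>

lemma quads_at:
  assumes b: "b \<in> quads" and p: "p \<in> b"
  obtains S c where "S \<in> frame c" "b = (+) p ` insert 0 S"
proof -
  obtain a S c where S: "fst a \<in> V" "S \<in> frame c" "b = (+) a ` insert 0 S"
    using b unfolding quads_def by blast
  show ?thesis
  proof (cases "p = a")
    case True
    then show ?thesis using S that by blast
  next
    case False
    then have t: "a + p \<in> S" using p add_pt_eq_0[of a p] unfolding S(3) mem_shift by blast
    define t where "t = a + p"
    obtain d where d: "insert t ((+) t ` (S - {t})) \<in> frame d"
      using frame_shift[OF S(2) t] unfolding t_def by blast
    \<comment> \<open>The base changes from \<open>a\<close> to \<open>p\<close>: translation by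
      \<open>t\<close> swaps 0 and \<open>t\<close> and shifts the other two points.\<close>
    have "a = p + t" by (simp only: t_def add.commute[of a p] add_self_pt_left)
    have "b = (+) p ` (+) t ` insert 0 S"
      unfolding S(3) \<open>a = p + t\<close> by (simp add: image_image add_ac)
    also have "insert 0 S = insert 0 (insert t (S - {t}))" using t unfolding t_def by blast
    also have "(+) t ` \<dots> = insert 0 (insert t ((+) t ` (S - {t})))"
      by (simp only: image_insert add_self_pt add_0_right insert_commute)
    finally show ?thesis using d that by blast
  qed
qed

lemma quads_sub:
  assumes "b \<in> quads" shows "b \<subseteq> V \<times> UNIV" and "card b = 4"
proof -
  obtain a S c where S: "fst a \<in> V" "S \<in> frame c" "b = (+) a ` insert 0 S"
    using assms unfolding quads_def by blast
  have "fst q \<in> V" if "q \<in> b" for q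
    using that S frame_holey(3)[OF S(2)] add_mem zero_mem by auto
  then show "b \<subseteq> V \<times> UNIV" by (auto simp: mem_Times_iff)
  have "finite S" "card S = 3" using frame_card[OF S(2)] by (auto intro: card_ge_0_finite)
  then show "card b = 4"
    using zero_notin_frame[OF S(2)] unfolding S(3) by (subst card_image) (simp_all add: inj_on_def)
qed

lemma quads_indep:
  assumes b: "b \<in> quads" and pqr: "p \<in> b" "q \<in> b" "r \<in> b" "distinct [p, q, r]"
  shows "indep w (fst p + fst q) (fst p + fst r)"
proof -
  obtain S c where S: "S \<in> frame c" "b = (+) p ` insert 0 S" using quads_at[OF b pqr(1)] .
  have "p + q \<in> S" "p + r \<in> S" "p + q \<noteq> p + r"
    using pqr add_pt_eq_0[of p q] add_pt_eq_0[of p r] unfolding S(2) mem_shift by auto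
  from frame_third[OF S(1) this] show ?thesis by simp
qed

lemma quads_ex1:
  assumes V: "fst p \<in> V" "fst q \<in> V" "fst r \<in> V" and i: "indep w (fst p + fst q) (fst p + fst r)"
  shows "\<exists>!b. b \<in> quads \<and> p \<in> b \<and> q \<in> b \<and> r \<in> b"
proof -
  have "fst (p + q) \<in> V" "fst (p + r) \<in> V" "indep w (fst (p + q)) (fst (p + r))"
    using assms add_mem by auto
  then obtain c S where S: "S \<in> frame c" "p + q \<in> S" "p + r \<in> S"
    and u: "\<And>d S'. \<lbrakk>S' \<in> frame d; p + q \<in> S'; p + r \<in> S'\<rbrakk> \<Longrightarrow> d = c \<and> S' = S"
    by (rule frame_pair) blast
  show ?thesis
  proof (rule ex1I[of _ "(+) p ` insert 0 S"])
    show "(+) p ` insert 0 S \<in> quads \<and> p \<in> (+) p ` insert 0 S \<and> q \<in> (+) p ` insert 0 S \<and> r \<in> (+) p ` insert 0 S"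
      unfolding mem_shift using S quadsI[OF V(1) S(1)] by (simp only: add_self_pt insert_iff simp_thms)
    fix b assume b: "b \<in> quads \<and> p \<in> b \<and> q \<in> b \<and> r \<in> b"
    then obtain S' d where S': "S' \<in> frame d" "b = (+) p ` insert 0 S'" using quads_at by metis
    then have "p + q \<in> insert 0 S'" "p + r \<in> insert 0 S'"
      using b unfolding S'(2) mem_shift by blast+
    moreover have "p + q \<noteq> 0" "p + r \<noteq> 0" using S frame_pt_neq_0 by blast+
    ultimately have "S' = S" using u S'(1) by blast
    then show "b = (+) p ` insert 0 S" using S' by simp
  qed
qed

lemma quad_class_sub: "fst p \<in> V \<Longrightarrow> quad_class p c \<subseteq> {b \<in> quads. p \<in> b}"
  unfolding quad_class_def using quadsI[of p] by (auto simp only: mem_shift add_self_pt mem_Collect_eq insertI1)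

lemma quad_class_indep:
  assumes "b \<in> quad_class p c" "q \<in> b" "q \<noteq> p"
  shows "indep w (fst p + c) (fst p + fst q)"
proof -
  obtain S where S: "S \<in> frame (fst p + c)" "b = (+) p ` insert 0 S"
    using assms unfolding quad_class_def by blast
  have "p + q \<in> S" using assms(2,3) add_pt_eq_0[of p q] unfolding S(2) mem_shift by blast
  then show ?thesis using frame_holey(1)[OF S(1)] by fastforce
qed

lemma quad_class_ex1:
  assumes V: "fst p \<in> V" "fst q \<in> V" "c \<in> V" and i: "indep w (fst p + c) (fst p + fst q)"
  shows "\<exists>!b. b \<in> quad_class p c \<and> q \<in> b"
proof -
  have "fst p + c \<in> V" "fst (p + q) \<in> V" "indep w (fst p + c) (fst (p + q))"
    using assms add_mem by auto
  then obtain S where S: "S \<in> frame (fst p + c)" "p + q \<in> S"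
    and u: "\<And>S'. \<lbrakk>S' \<in> frame (fst p + c); p + q \<in> S'\<rbrakk> \<Longrightarrow> S' = S"
    using frame_ex1 by metis
  show ?thesis
  proof (rule ex1I[of _ "(+) p ` insert 0 S"])
    show "(+) p ` insert 0 S \<in> quad_class p c \<and> q \<in> (+) p ` insert 0 S"
      unfolding mem_shift using S unfolding quad_class_def by blast
    fix b assume b: "b \<in> quad_class p c \<and> q \<in> b"
    then obtain S' where S': "S' \<in> frame (fst p + c)" "b = (+) p ` insert 0 S'"
      unfolding quad_class_def by blast
    then have "p + q \<in> insert 0 S'" using b unfolding S'(2) mem_shift by (elim conjE)
    moreover have "p + q \<noteq> 0" using S frame_pt_neq_0 by blast
    ultimately have "S' = S" using u S'(1) by blast
    then show "b = (+) p ` insert 0 S" using S' by simp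
  qed
qed

text \<open>With \<open>p\<close> as origin the block is a frame triple \<open>S\<close>, and two of
  its points determine its label by \<open>frame_pair\<close>.\<close>

lemma quad_class_colour:
  assumes b: "b \<in> quads" and p: "p \<in> b"
  shows "\<exists>!c. c \<in> V \<and> b \<in> quad_class p c"
proof -
  obtain S d where S: "S \<in> frame d" "b = (+) p ` insert 0 S" using quads_at[OF assms] .
  have pV: "fst p \<in> V" using quads_sub(1)[OF b] p by auto
  obtain q where q: "q \<in> S" using frame_card[OF S(1)] by (metis card.empty ex_in_conv zero_neq_numeral)
  obtain r where r: "r \<in> S" "r \<noteq> q"
  proof -
    have "S \<noteq> {q}" using frame_card[OF S(1)] by auto
    then show thesis using q that by blast
  qed
  have dV: "d \<in> V" and qV: "fst q \<in> V" "fst r \<in> V" using frame_holey[OF S(1)] q r by blast+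
  have iqr: "indep w (fst q) (fst r)" using frame_third[OF S(1) q r(1)] r(2) by blast
  show ?thesis
  proof (rule ex1I[of _ "fst p + d"])
    show "fst p + d \<in> V \<and> b \<in> quad_class p (fst p + d)"
      using S pV dV add_mem unfolding quad_class_def by (auto simp: add_self_left)
    fix c assume c: "c \<in> V \<and> b \<in> quad_class p c"
    then obtain S' where S': "S' \<in> frame (fst p + c)" "b = (+) p ` insert 0 S'"
      unfolding quad_class_def by blast
    have "inj ((+) p)" by (simp add: inj_def)
    moreover have "(+) p ` insert 0 S' = (+) p ` insert 0 S" by (simp only: S(2)[symmetric] S'(2)[symmetric])
    ultimately have "insert 0 S' = insert 0 S" by (simp only: inj_image_eq_iff)
    then have "S' = S" using zero_notin_frame S(1) S'(1) by (metis insert_ident)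
    then have "fst p + c = d"
      using frame_pair[OF qV iqr] S(1) S'(1) q r(1) by metis
    then show "c = fst p + d" by (simp add: add_self_left flip: \<open>fst p + c = d\<close>)
  qed
qed

text \<open>The nonzero \<open>d\<close> guarantees a line through every point. Each line gets a
  copy of the SQS(10), and \<open>quads\<close> and \<open>quad_class\<close> serve as
  \<open>H\<close> and \<open>M\<close>.\<close>

lemma stemmed_ex:
  assumes nontrivial: "d \<in> V" "d \<noteq> 0"
  shows "\<exists>B K. stemmed V B K"
proof -
  have "\<exists>B K. stemmed l B K" if l: "l \<in> lines" for l
  proof -
    obtain g :: "f4 \<Rightarrow> 'v" where "inj g" "range g = l" using line_param[OF l] by blast
    then show ?thesis using stemmed_image[OF stemmed10, of g] by simp
  qed
  then obtain Bl Kl where BK: "\<And>l. l \<in> lines \<Longrightarrow> stemmed l (Bl l) (Kl l)" by metis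
  note nc = not_collinear_iff[OF _ _ nontrivial]
  interpret stem_glue V lines Bl Kl quads quad_class
  proof
    fix b p q r assume b: "b \<in> quads" "p \<in> b" "q \<in> b" "r \<in> b" "distinct [p, q, r]"
    then have "fst p \<in> V" "fst q \<in> V" "fst r \<in> V" using quads_sub(1)[OF b(1)] by auto
    with nc quads_indep[OF b]
    show "\<not> collinear lines (fst p) (fst q) (fst r)" by blast
  next
    fix p q r :: "'v \<times> bit"
    assume "fst p \<in> V" "fst q \<in> V" "fst r \<in> V" "\<not> collinear lines (fst p) (fst q) (fst r)"
    then show "\<exists>!b. b \<in> quads \<and> p \<in> b \<and> q \<in> b \<and> r \<in> b"
      using quads_ex1 nc by blast
  next
    fix p q :: "'v \<times> bit" and c b
    assume *: "fst p \<in> V" "c \<in> V" "b \<in> quad_class p c" "q \<in> b" "q \<noteq> p"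
    then have "fst q \<in> V" using quad_class_sub quads_sub(1) by fastforce
    then show "\<not> collinear lines (fst p) c (fst q)"
      using quad_class_indep[OF *(3-5)] nc * by blast
  next
    fix p q :: "'v \<times> bit" and c
    assume "fst p \<in> V" "fst q \<in> V" "c \<in> V" "\<not> collinear lines (fst p) c (fst q)"
    then show "\<exists>!b. b \<in> quad_class p c \<and> q \<in> b" using quad_class_ex1 nc by blast
  next
    show "l \<subseteq> V" "stemmed l (Bl l) (Kl l)" if "l \<in> lines" for l
      using that line_sub BK by simp_all
    show "\<exists>l\<in>lines. x \<in> l \<and> y \<in> l" if "x \<in> V" "y \<in> V" for x y
      by (rule line_ex[OF that nontrivial])
    show "l = m" if "l \<in> lines" "m \<in> lines" "x \<in> l" "x \<in> m" "y \<in> l" "y \<in> m" "x \<noteq> y" for l m x y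
      by (rule line_unique[OF that])
    show "b \<subseteq> V \<times> UNIV \<and> card b = 4" if "b \<in> quads" for b
      using quads_sub[OF that] by simp
    show "quad_class p c \<subseteq> {b \<in> quads. p \<in> b}" if "fst p \<in> V" for p c
      by (rule quad_class_sub[OF that])
    show "\<exists>!c. c \<in> V \<and> b \<in> quad_class p c" if "b \<in> quads" "p \<in> b" for b p
      by (rule quad_class_colour[OF that])
  qed
  show ?thesis using stemmed_glue by blast
qed

end

section \<open>The construction\<close>

text \<open>Sequences vanishing from position \<open>n\<close> on keep the dimension out of the
  type.\<close>

definition vectors :: "nat \<Rightarrow> (nat \<Rightarrow> f4) set" where
  "vectors n = {f. \<forall>i\<ge>n. f i = 0}"

lemma card_vectors: "finite (vectors n)" "card (vectors n) = 4 ^ n"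
proof -
  have "bij_betw (\<lambda>f. restrict f {..<n}) (vectors n) (PiE {..<n} (\<lambda>_. UNIV :: f4 set))"
  proof (rule bij_betwI[where g = "\<lambda>f i. if i < n then f i else 0"])
    show "(\<lambda>f. restrict f {..<n}) \<in> vectors n \<rightarrow> PiE {..<n} (\<lambda>_. UNIV)" by auto
    show "(\<lambda>f i. if i < n then f i else 0) \<in> PiE {..<n} (\<lambda>_. UNIV) \<rightarrow> vectors n"
      by (auto simp: vectors_def)
    show "(\<lambda>i. if i < n then restrict f {..<n} i else 0) = f" if "f \<in> vectors n" for f
      using that by (auto simp: vectors_def fun_eq_iff)
    show "restrict (\<lambda>i. if i < n then f i else 0) {..<n} = f" if "f \<in> PiE {..<n} (\<lambda>_. UNIV)" for f
      using that by (auto simp: fun_eq_iff PiE_def extensional_def)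
  qed
  moreover have "finite (UNIV :: f4 set)" "card (UNIV :: f4 set) = 4"
    by (simp_all add: UNIV_bit card_cartesian_product finite_prod flip: UNIV_Times_UNIV)
  ultimately show "finite (vectors n)" "card (vectors n) = 4 ^ n"
    using finite_PiE[of "{..<n}" "\<lambda>_. UNIV :: f4 set"]
    by (simp_all add: bij_betw_finite bij_betw_same_card card_PiE)
qed

lemma f4_space_vectors: "f4_space ((\<circ>) om) (vectors n)"
proof
  have om0: "om 0 = 0" by (simp add: zero_prod_def)
  show "x + x = 0" for x :: "nat \<Rightarrow> f4" by (simp add: fun_eq_iff prod_eq_iff)
  show "om \<circ> (x + y) = (om \<circ> x) + (om \<circ> y)" for x y by (simp add: fun_eq_iff om_add)
  show "om \<circ> (om \<circ> x) = (om \<circ> x) + x" for x by (simp add: fun_eq_iff om_om)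
  show "om \<circ> x \<in> vectors n" if "x \<in> vectors n" for x
    using that om0 by (simp add: vectors_def)
qed (simp_all add: vectors_def)

text \<open>For n = 0 the space is a single point without lines; the SQS(4) is one block with one
  label.\<close>

lemma coloured_SQS_single:
  assumes "card X = 4" shows "coloured_SQS X {X} {()} (\<lambda>_ _. {X})"
  using assms by (auto simp: coloured_SQS_def)

lemma card_stem_points:
  assumes "finite V" shows "finite (stem_points V)" "card (stem_points V) = 2 * card V + 2"
  using assms by (simp_all add: stem_points_def card_Plus card_cartesian_product UNIV_bit finite_cartesian_product)

lemma RDSQS_nat:
  assumes S: "coloured_SQS X B C K" and "finite X" "2 \<le> card X"
  shows "\<exists>(Y :: nat set) D. card Y = card X \<and> is_RDSQS Y D"
proof -
  obtain f :: "'a \<Rightarrow> nat" where f: "inj_on f X"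
    using finite_imp_inj_to_nat_seg[OF \<open>finite X\<close>] by blast
  have c: "card (f ` X) = card X" by (rule card_image[OF f])
  have "\<exists>q\<in>f ` X. q \<noteq> p" for p
  proof (rule ccontr)
    assume "\<not> (\<exists>q\<in>f ` X. q \<noteq> p)"
    then have "f ` X \<subseteq> {p}" by blast
    from card_mono[OF _ this] c assms(3) show False by simp
  qed
  then have "is_RDSQS (f ` X) ((`) f ` B)"
    using coloured_SQS_imp_RDSQS[OF coloured_SQS_image[OF S f inj_on_id]] \<open>finite X\<close> by blast
  with c show ?thesis by blast
qed

theorem theorem3p2:
  fixes n :: nat
  shows "\<exists>(X :: nat set) B. card X = 2 ^ (2 * n + 1) + 2 \<and> is_RDSQS X B"
proof -
  let ?X = "stem_points (vectors n)"
  have X: "finite ?X" "card ?X = 2 ^ (2 * n + 1) + 2"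
    using card_stem_points[OF card_vectors(1)] card_vectors(2) by (simp_all add: power_mult)
  show ?thesis
  proof (cases "n = 0")
    case True
    then have "coloured_SQS ?X {?X} {()} (\<lambda>_ _. {?X})"
      using X(2) by (intro coloured_SQS_single) simp
    from RDSQS_nat[OF this X(1)] X(2) show ?thesis by simp
  next
    case False
    interpret f4_space "(\<circ>) om" "vectors n" by (rule f4_space_vectors)
    \<comment> \<open>The first unit vector, which lies in \<open>vectors n\<close> because
      \<open>n\<close> is positive.\<close>
    let ?d = "\<lambda>i. if i = 0 then (1, 0) else 0 :: f4"
    have "?d \<in> vectors n" "?d \<noteq> 0" using False by (auto simp: vectors_def fun_eq_iff zero_prod_def)
    then obtain B K where "stemmed (vectors n) B K" using stemmed_ex by blast
    then have "coloured_SQS ?X B (vectors n) K" by (simp add: stemmed_def)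
    from RDSQS_nat[OF this X(1)] X(2) show ?thesis by simp
  qed
qed

end
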